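(* Let $k$ be a field with $k \subseteq \mathbb{R}$ and let $k_0 \subset k$ be a computable subfield. Then the following problem is undecidable: given a finite system of difference equations with coefficients in $k_0$ (in finitely many unknowns), determine whether it has a solution in $k^{\mathbb{N}}$. Likewise, the following problem is undecidable: given a finite system of difference equations with coefficients in $k_0$, determine whether it has a solution in $k^{\mathbb{Z}}$.
   Context: $\mathbb{N}$ is the set of nonnegative integers. For $M=\mathbb{N}$ or $\mathbb{Z}$, the ring $k^M$ of sequences has componentwise operations and shift endomorphism $\sigma((x_i)_{i\in M})=(x_{i+1})_{i\in M}$; $k$ embeds as the constant sequences. A difference polynomial over $k_0$ in unknowns $\mathbf{X}=(X_1,\ldots,X_n)$ is an element of the polynomial ring $k_0[\sigma^j(X_1),\ldots,\sigma^j(X_n)\mid j\in\mathbb{N}]$ (in the indeterminates $\sigma^j(X_i)$), on which $\sigma$ acts trivially on $k_0$ and by $\sigma(\sigma^j(X_i))=\sigma^{j+1}(X_i)$. A system of difference equations is $F=0$ for a set $F$ of difference polynomials; a solution in $k^M$ is a tuple $\mathbf{x}\in(k^M)^n$ such that every $f\in F$ is sent to $0$ by the unique $k_0$-algebra morphism $k_0[\sigma^j(\mathbf{X})\mid j\in\mathbb{N}]\to k^M$ commuting with $\sigma$ and sending $X_i\mapsto x_i$. "Undecidable" means that no algorithm solves the problem. *)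

theory Defs
  imports
    Complex_Main
    "HOL-Library.Nat_Bijection"
    "HOL-Library.Function_Algebras"
    "HOL-Library.Poly_Mapping"
    "HOL-Algebra.Algebraic_Closure_Type"
begin

section \<open>Algorithms: partial recursive functions\<close>

datatype recf =
    Zero_rf
  | Succ_rf
  | Proj_rf nat
  | Comp_rf recf "recf list"
  | Prim_rf recf recf
  | Min_rf recf

text \<open>\<open>rec_eval r xs y\<close>: the computation of \<open>r\<close> on the arguments \<open>xs\<close> terminates with value \<open>y\<close>.
  In \<open>Min_rf f\<close>, all values of \<open>f\<close> below the least zero have to be defined, as usual for the
  unbounded search operator.\<close>

inductive rec_eval :: "recf \<Rightarrow> nat list \<Rightarrow> nat \<Rightarrow> bool" where
  zero: "rec_eval Zero_rf xs 0"
| succ: "rec_eval Succ_rf [x] (Suc x)"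
| proj: "i < length xs \<Longrightarrow> rec_eval (Proj_rf i) xs (xs ! i)"
| comp: "list_all2 (\<lambda>g y. rec_eval g xs y) gs ys \<Longrightarrow> rec_eval f ys z \<Longrightarrow>
    rec_eval (Comp_rf f gs) xs z"
| prim_0: "rec_eval f xs z \<Longrightarrow> rec_eval (Prim_rf f g) (0 # xs) z"
| prim_Suc: "rec_eval (Prim_rf f g) (m # xs) y \<Longrightarrow> rec_eval g (m # y # xs) z \<Longrightarrow>
    rec_eval (Prim_rf f g) (Suc m # xs) z"
| mini: "rec_eval f (m # xs) 0 \<Longrightarrow> (\<forall>l<m. \<exists>y. rec_eval f (l # xs) (Suc y)) \<Longrightarrow>
    rec_eval (Min_rf f) xs m"

inductive_cases rec_eval_elims:
  "rec_eval Zero_rf xs y"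
  "rec_eval Succ_rf xs y"
  "rec_eval (Proj_rf i) xs y"
  "rec_eval (Comp_rf f gs) xs y"
  "rec_eval (Prim_rf f g) (0 # xs) y"
  "rec_eval (Prim_rf f g) (Suc m # xs) y"
  "rec_eval (Min_rf f) xs y"

lemma rec_eval_unique: "rec_eval r xs y \<Longrightarrow> rec_eval r xs z \<Longrightarrow> y = z"
proof (induction arbitrary: z rule: rec_eval.induct)
  case (comp xs gs ys f w)
  from comp.prems obtain ys' where ys': "list_all2 (\<lambda>g y. rec_eval g xs y) gs ys'"
    and z: "rec_eval f ys' z"
    by (rule rec_eval_elims(4)) blast
  have "ys = ys'"
    using comp.IH(1) ys' by (auto simp: list_all2_conv_all_nth intro!: nth_equalityI)
  with z comp.IH(2) show ?case by simp
next
  case (prim_Suc f g m xs y w)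
  from prim_Suc.prems obtain y' where "rec_eval (Prim_rf f g) (m # xs) y'"
    "rec_eval g (m # y' # xs) z"
    by (rule rec_eval_elims(6)) blast
  with prim_Suc.IH show ?case by metis
next
  case (mini f m xs)
  from mini.prems have z: "rec_eval f (z # xs) 0" "\<forall>l<z. \<exists>y. rec_eval f (l # xs) (Suc y)"
    by (rule rec_eval_elims(7), blast)+
  have "\<not> m < z"
  proof
    assume "m < z"
    with z(2) obtain y where "rec_eval f (m # xs) (Suc y)" by blast
    then show False using mini.IH(1)[of "Suc y"] by simp
  qed
  moreover have "\<not> z < m"
  proof
    assume "z < m"
    with mini.IH(2) obtain y where "\<And>w. rec_eval f (z # xs) w \<Longrightarrow> Suc y = w" by blast
    from this[OF z(1)] show False by simp
  qed
  ultimately show ?case by simp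
next
  case (zero xs)
  then show ?case by (rule rec_eval_elims(1)) simp
next
  case (succ x)
  then show ?case by (rule rec_eval_elims(2)) simp
next
  case (proj i xs)
  from proj.prems show ?case by (rule rec_eval_elims(3)) simp
next
  case (prim_0 f xs w g)
  from prim_0.prems have "rec_eval f xs z" by (rule rec_eval_elims(5))
  then show ?case by (rule prim_0.IH)
qed

text \<open>The problem ``given an instance \<open>x \<in> I\<close>, determine whether \<open>P x\<close>'', where the instance is
  handed to the algorithm as the natural number \<open>enc x\<close>.  Nothing is required of the
  algorithm on numbers that do not encode an instance.\<close>

definition decidable_on :: "('a \<Rightarrow> nat) \<Rightarrow> 'a set \<Rightarrow> ('a \<Rightarrow> bool) \<Rightarrow> bool" where
  "decidable_on enc I P \<longleftrightarrow> (\<exists>r. \<forall>x\<in>I. rec_eval r [enc x] (if P x then 1 else 0))"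


section \<open>Subfields of the reals and computable subfields\<close>

abbreviation real_field :: "real ring" where
  "real_field \<equiv> ring_of_type_algebra"

lemma subfield_real_iff:
  "subfield K real_field \<longleftrightarrow> 1 \<in> K \<and> (\<forall>a\<in>K. \<forall>b\<in>K. a - b \<in> K \<and> a * b \<in> K) \<and>
     (\<forall>a\<in>K. a \<noteq> 0 \<longrightarrow> inverse a \<in> K)"
  (is "_ \<longleftrightarrow> ?closed")
proof -
  interpret R: field real_field by (rule field_from_type_algebra)
  have ring_simps: "carrier real_field = UNIV" "\<one>\<^bsub>real_field\<^esub> = 1" "\<zero>\<^bsub>real_field\<^esub> = 0"
    "x \<otimes>\<^bsub>real_field\<^esub> y = x * y" "x \<oplus>\<^bsub>real_field\<^esub> y = x + y" for x y
    by (simp_all add: ring_of_type_algebra_def)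
  have minus: "\<ominus>\<^bsub>real_field\<^esub> x = - x" for x
    by (rule R.minus_equality) (simp_all add: ring_simps)
  have inv: "inv\<^bsub>real_field\<^esub> x = inverse x" if "x \<noteq> 0" for x
    by (rule R.comm_inv_char) (use that in \<open>simp_all add: ring_simps\<close>)
  show ?thesis
  proof
    assume K: "subfield K real_field"
    then interpret K: subfield K real_field .
    have "a + b \<in> K" if "a \<in> K" "b \<in> K" for a b
      using K.subring_axioms subringE(7)[of K real_field a b] that
      by (simp add: ring_simps)
    moreover have "- a \<in> K" if "a \<in> K" for a
      using K.subring_axioms subringE(5)[of K real_field a] that
      by (simp add: minus)
    ultimately have "a - b \<in> K" if "a \<in> K" "b \<in> K" for a b
      using that by (simp only: diff_conv_add_uminus)
    moreover have "a * b \<in> K" if "a \<in> K" "b \<in> K" for a b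
      using K.subring_axioms subringE(6)[of K real_field a b] that
      by (simp add: ring_simps)
    moreover have "1 \<in> K"
      using subringE(3)[OF K.subring_axioms] by (simp add: ring_simps)
    moreover have "inverse a \<in> K" if "a \<in> K" "a \<noteq> 0" for a
      using R.subfield_m_inv(1)[OF K, of a] that by (simp add: ring_simps inv)
    ultimately show ?closed by simp
  next
    assume K: ?closed
    then have "1 - 1 \<in> K" by blast
    then have zero: "0 \<in> K" by simp
    have neg: "- a \<in> K" if "a \<in> K" for a
    proof -
      have "0 - a \<in> K" using K zero that by blast
      then show ?thesis by simp
    qed
    have add: "a + b \<in> K" if "a \<in> K" "b \<in> K" for a b
    proof -
      have "a - (- b) \<in> K" using K neg that by blast
      then show ?thesis by simp
    qed
    have "subring K real_field"
      by (rule R.subringI) (use K neg add in \<open>auto simp: ring_simps minus\<close>)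
    then show "subfield K real_field"
      by (intro R.subfieldI' \<open>subring K real_field\<close>) (use K inv in \<open>simp_all add: ring_simps\<close>)
  qed
qed

lemma
  assumes K: "subfield K real_field"
  shows subfield_real_0: "0 \<in> K" and subfield_real_1: "1 \<in> K"
    and subfield_real_add: "a \<in> K \<Longrightarrow> b \<in> K \<Longrightarrow> a + b \<in> K"
  using subringE(2,3)[OF subfieldE(1)[OF K]] subringE(7)[OF subfieldE(1)[OF K], of a b]
  by (simp_all add: ring_of_type_algebra_def)

text \<open>An admissible indexing in the sense of Rabin.  Equality of indices is decidable, and zero,
  one, subtraction and inverses are then computable as well, the latter two by search.\<close>

definition computable_field :: "real set \<Rightarrow> (real \<Rightarrow> nat) \<Rightarrow> bool" where
  "computable_field K \<nu> \<longleftrightarrow>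
     subfield K real_field \<and>
     inj_on \<nu> K \<and>
     decidable_on (\<lambda>w. w) UNIV (\<lambda>w. w \<in> \<nu> ` K) \<and>
     (\<exists>r. \<forall>a\<in>K. \<forall>b\<in>K. rec_eval r [\<nu> a, \<nu> b] (\<nu> (a + b))) \<and>
     (\<exists>r. \<forall>a\<in>K. \<forall>b\<in>K. rec_eval r [\<nu> a, \<nu> b] (\<nu> (a * b)))"


section \<open>Sequences and difference polynomials\<close>

text \<open>\<open>'m\<close> is \<open>nat\<close> or \<open>int\<close>; the ring structure on \<open>'m \<Rightarrow> real\<close> is the componentwise one.\<close>

definition seqs :: "real set \<Rightarrow> ('m \<Rightarrow> real) set" where
  "seqs k = {x. range x \<subseteq> k}"

definition shift :: "('m::{plus,one} \<Rightarrow> real) \<Rightarrow> 'm \<Rightarrow> real" where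
  "shift x = (\<lambda>i. x (i + 1))"

text \<open>The pair \<open>(i, j)\<close> stands for the indeterminate \<open>\<sigma>\<^sup>j(X\<^sub>i)\<close>; unknowns are numbered from 0.
  A monomial maps each indeterminate to its exponent.\<close>

type_synonym dmono = "(nat \<times> nat) \<Rightarrow>\<^sub>0 nat"
type_synonym dpoly = "dmono \<Rightarrow>\<^sub>0 real"

definition dpolys :: "real set \<Rightarrow> nat \<Rightarrow> dpoly set" where
  "dpolys k0 n = {f. (\<forall>m. Poly_Mapping.lookup f m \<in> k0) \<and> (\<forall>m\<in>Poly_Mapping.keys f. \<forall>(i, j)\<in>Poly_Mapping.keys m. i < n)}"

definition dconst :: "real \<Rightarrow> dpoly" where
  "dconst c = Poly_Mapping.single 0 c"

definition dvar :: "nat \<Rightarrow> nat \<Rightarrow> dpoly" where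
  "dvar i j = Poly_Mapping.single (Poly_Mapping.single (i, j) 1) 1"

definition dmono_shift :: "dmono \<Rightarrow> dmono" where
  "dmono_shift m = (\<Sum>(i, j)\<in>Poly_Mapping.keys m. Poly_Mapping.single (i, Suc j) (Poly_Mapping.lookup m (i, j)))"

definition dpoly_shift :: "dpoly \<Rightarrow> dpoly" where
  "dpoly_shift f = (\<Sum>m\<in>Poly_Mapping.keys f. Poly_Mapping.single (dmono_shift m) (Poly_Mapping.lookup f m))"

definition dmono_eval :: "(nat \<Rightarrow> 'm::{plus,one} \<Rightarrow> real) \<Rightarrow> dmono \<Rightarrow> 'm \<Rightarrow> real" where
  "dmono_eval x m = (\<Prod>(i, j)\<in>Poly_Mapping.keys m. (shift ^^ j) (x i) ^ Poly_Mapping.lookup m (i, j))"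

definition dpoly_eval :: "(nat \<Rightarrow> 'm::{plus,one} \<Rightarrow> real) \<Rightarrow> dpoly \<Rightarrow> 'm \<Rightarrow> real" where
  "dpoly_eval x f = (\<Sum>m\<in>Poly_Mapping.keys f. (\<lambda>_. Poly_Mapping.lookup f m) * dmono_eval x m)"

text \<open>\<open>dpoly_eval x\<close> is the unique \<open>k0\<close>-algebra morphism on \<open>dpolys k0 n\<close> that commutes with the
  shifts and sends \<open>X\<^sub>i\<close> to \<open>x i\<close>: see \<open>dpoly_eval_morphism\<close> and \<open>dpoly_morphism_unique\<close> below.\<close>

definition diff_alg_morphism ::
  "real set \<Rightarrow> nat \<Rightarrow> (nat \<Rightarrow> 'm::{plus,one} \<Rightarrow> real) \<Rightarrow> (dpoly \<Rightarrow> 'm \<Rightarrow> real) \<Rightarrow> bool" where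
  "diff_alg_morphism k0 n x \<phi> \<longleftrightarrow>
     (\<forall>f\<in>dpolys k0 n. \<forall>g\<in>dpolys k0 n. \<phi> (f + g) = \<phi> f + \<phi> g \<and> \<phi> (f * g) = \<phi> f * \<phi> g) \<and>
     (\<forall>c\<in>k0. \<phi> (dconst c) = (\<lambda>_. c)) \<and>
     (\<forall>f\<in>dpolys k0 n. \<phi> (dpoly_shift f) = shift (\<phi> f)) \<and>
     (\<forall>i<n. \<phi> (dvar i 0) = x i)"

definition solutions :: "real set \<Rightarrow> nat \<Rightarrow> dpoly set \<Rightarrow> (nat \<Rightarrow> 'm::{plus,one} \<Rightarrow> real) set" where
  "solutions k n F = {x \<in> {..<n} \<rightarrow>\<^sub>E seqs k. \<forall>f\<in>F. dpoly_eval x f = 0}"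


section \<open>Finite systems as inputs of algorithms\<close>

text \<open>A polynomial is written as a list of terms, a term as a coefficient together with a list of
  powers \<open>((i, j), e)\<close> of indeterminates.  A system is given by its number of unknowns
  and a list of polynomials.\<close>

type_synonym dterm = "real \<times> ((nat \<times> nat) \<times> nat) list"
type_synonym dsys = "nat \<times> dterm list list"

definition mono_of :: "((nat \<times> nat) \<times> nat) list \<Rightarrow> dmono" where
  "mono_of ps = (\<Sum>(v, e)\<leftarrow>ps. Poly_Mapping.single v e)"

definition poly_of :: "dterm list \<Rightarrow> dpoly" where
  "poly_of ts = (\<Sum>(c, ps)\<leftarrow>ts. Poly_Mapping.single (mono_of ps) c)"

definition polys_of :: "dterm list list \<Rightarrow> dpoly set" where
  "polys_of fs = poly_of ` set fs"

definition dsystems :: "real set \<Rightarrow> dsys set" where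
  "dsystems k0 = {(n, fs). \<forall>ts\<in>set fs. \<forall>(c, ps)\<in>set ts. c \<in> k0 \<and> (\<forall>((i, j), e)\<in>set ps. i < n)}"

definition term_code :: "(real \<Rightarrow> nat) \<Rightarrow> dterm \<Rightarrow> nat" where
  "term_code \<nu> = (\<lambda>(c, ps). prod_encode (\<nu> c,
     list_encode (map (\<lambda>(v, e). prod_encode (prod_encode v, e)) ps)))"

definition dsys_code :: "(real \<Rightarrow> nat) \<Rightarrow> dsys \<Rightarrow> nat" where
  "dsys_code \<nu> = (\<lambda>(n, fs). prod_encode (n,
     list_encode (map (\<lambda>ts. list_encode (map (term_code \<nu>) ts)) fs)))"


section \<open>Adequacy of the definitions\<close>

subsection \<open>Evaluation is the unique morphism\<close>

lemma poly_mapping_sum_single: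
  fixes f :: "'a \<Rightarrow>\<^sub>0 'b::comm_monoid_add"
  shows "(\<Sum>m\<in>Poly_Mapping.keys f. Poly_Mapping.single m (Poly_Mapping.lookup f m)) = f"
proof (rule poly_mapping_eqI)
  fix l
  have "Poly_Mapping.lookup (\<Sum>m\<in>Poly_Mapping.keys f. Poly_Mapping.single m (Poly_Mapping.lookup f m)) l =
      (\<Sum>m\<in>Poly_Mapping.keys f. if m = l then Poly_Mapping.lookup f l else 0)"
    unfolding lookup_sum by (rule sum.cong) (auto simp: lookup_single when_def)
  then show "Poly_Mapping.lookup (\<Sum>m\<in>Poly_Mapping.keys f. Poly_Mapping.single m (Poly_Mapping.lookup f m)) l =
      Poly_Mapping.lookup f l"
    by (simp add: in_keys_iff)
qed

lemma dpolys_add: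
  assumes "subfield k0 real_field" "f \<in> dpolys k0 n" "g \<in> dpolys k0 n"
  shows "f + g \<in> dpolys k0 n"
proof -
  have "Poly_Mapping.lookup (f + g) m \<in> k0" for m
    using subfield_real_add[OF assms(1)] assms(2,3) by (auto simp: dpolys_def lookup_add)
  moreover have "Poly_Mapping.keys (f + g) \<subseteq> Poly_Mapping.keys f \<union> Poly_Mapping.keys g"
    by (rule keys_add)
  ultimately show ?thesis
    using assms(2,3) unfolding dpolys_def by blast
qed

lemma dpolys_single:
  assumes "subfield k0 real_field" "c \<in> k0" "\<forall>(i, j)\<in>Poly_Mapping.keys m. i < n"
  shows "Poly_Mapping.single m c \<in> dpolys k0 n"
  using assms subfield_real_0[OF assms(1)]
  by (auto simp: dpolys_def lookup_single when_def)

lemma dpolys_sum: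
  assumes "subfield k0 real_field" "\<And>a. a \<in> A \<Longrightarrow> f a \<in> dpolys k0 n"
  shows "sum f A \<in> dpolys k0 n"
proof -
  have "0 \<in> dpolys k0 n"
    using subfield_real_0[OF assms(1)] by (simp add: dpolys_def)
  with assms(2) show ?thesis
    by (induction A rule: infinite_finite_induct) (auto intro: dpolys_add[OF assms(1)])
qed

lemma dpoly_eval_add: "dpoly_eval x (f + g) = dpoly_eval x f + dpoly_eval x g"
proof -
  show ?thesis
    unfolding dpoly_eval_def
    by (rule setsum_keys_plus_distrib[where f = "\<lambda>m c. (\<lambda>_. c) * dmono_eval x m"])
       (auto simp: fun_eq_iff distrib_right)
qed

lemma dpoly_eval_0 [simp]: "dpoly_eval x 0 = 0"
  by (simp add: dpoly_eval_def)

lemma dpoly_eval_sum: "dpoly_eval x (sum f A) = (\<Sum>a\<in>A. dpoly_eval x (f a))"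
  by (induction A rule: infinite_finite_induct) (simp_all add: dpoly_eval_add)

lemma dpoly_eval_single: "dpoly_eval x (Poly_Mapping.single m c) = (\<lambda>_. c) * dmono_eval x m"
  by (auto simp: dpoly_eval_def fun_eq_iff)

lemma dmono_eval_superset:
  assumes "finite A" "Poly_Mapping.keys m \<subseteq> A"
  shows "dmono_eval x m = (\<Prod>(i, j)\<in>A. (shift ^^ j) (x i) ^ Poly_Mapping.lookup m (i, j))"
  unfolding dmono_eval_def
  by (rule prod.mono_neutral_left) (use assms in \<open>auto simp: in_keys_iff\<close>)

lemma dmono_eval_add: "dmono_eval x (m + l) = dmono_eval x m * dmono_eval x l"
proof -
  let ?A = "Poly_Mapping.keys m \<union> Poly_Mapping.keys l"
  have "dmono_eval x (m + l) = (\<Prod>(i, j)\<in>?A. (shift ^^ j) (x i) ^ Poly_Mapping.lookup (m + l) (i, j))"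
    using keys_add[of m l] by (intro dmono_eval_superset) auto
  also have "\<dots> = (\<Prod>(i, j)\<in>?A. (shift ^^ j) (x i) ^ Poly_Mapping.lookup m (i, j)) *
      (\<Prod>(i, j)\<in>?A. (shift ^^ j) (x i) ^ Poly_Mapping.lookup l (i, j))"
    unfolding prod.distrib[symmetric] by (rule prod.cong) (auto simp: lookup_add power_add)
  also have "\<dots> = dmono_eval x m * dmono_eval x l"
    by (subst (1 2) dmono_eval_superset[of ?A]) auto
  finally show ?thesis .
qed

lemma dmono_eval_0 [simp]: "dmono_eval x 0 = 1"
  by (simp add: dmono_eval_def)

lemma dmono_eval_sum: "dmono_eval x (sum f A) = (\<Prod>a\<in>A. dmono_eval x (f a))"
  by (induction A rule: infinite_finite_induct) (simp_all add: dmono_eval_add)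

lemma dmono_eval_single: "dmono_eval x (Poly_Mapping.single (i, j) e) = (shift ^^ j) (x i) ^ e"
  by (simp add: dmono_eval_def)

lemma dpoly_mult_eq:
  "f * g = (\<Sum>m\<in>Poly_Mapping.keys f. \<Sum>l\<in>Poly_Mapping.keys g. Poly_Mapping.single (m + l) (Poly_Mapping.lookup f m * Poly_Mapping.lookup g l))"
  for f g :: dpoly
proof -
  have "f * g = (\<Sum>m\<in>Poly_Mapping.keys f. Poly_Mapping.single m (Poly_Mapping.lookup f m)) *
      (\<Sum>l\<in>Poly_Mapping.keys g. Poly_Mapping.single l (Poly_Mapping.lookup g l))"
    using poly_mapping_sum_single[of f] poly_mapping_sum_single[of g] by simp
  then show ?thesis
    by (simp add: sum_product mult_single)
qed

lemma dpoly_eval_mult: "dpoly_eval x (f * g) = dpoly_eval x f * dpoly_eval x g"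
proof -
  have "dpoly_eval x (f * g) = (\<Sum>m\<in>Poly_Mapping.keys f. \<Sum>l\<in>Poly_Mapping.keys g.
      (\<lambda>_. Poly_Mapping.lookup f m * Poly_Mapping.lookup g l) * (dmono_eval x m * dmono_eval x l))"
    by (simp add: dpoly_mult_eq dpoly_eval_sum dpoly_eval_single dmono_eval_add)
  also have "\<dots> = (\<Sum>m\<in>Poly_Mapping.keys f. \<Sum>l\<in>Poly_Mapping.keys g.
      ((\<lambda>_. Poly_Mapping.lookup f m) * dmono_eval x m) * ((\<lambda>_. Poly_Mapping.lookup g l) * dmono_eval x l))"
    by (intro sum.cong) (auto simp: fun_eq_iff)
  also have "\<dots> = dpoly_eval x f * dpoly_eval x g"
    by (simp add: dpoly_eval_def sum_product)
  finally show ?thesis .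
qed

lemma shift_distribs:
  "shift 0 = 0" "shift 1 = 1" "shift (a + b) = shift a + shift b" "shift (a * b) = shift a * shift b"
  "shift (\<lambda>_. c) = (\<lambda>_. c)"
  by (simp_all add: shift_def fun_eq_iff)

lemma shift_power: "shift (a ^ e) = shift a ^ e"
  by (induction e) (simp_all only: power_0 power_Suc shift_distribs)

lemma shift_sum: "shift (sum f A) = (\<Sum>a\<in>A. shift (f a))"
  by (induction A rule: infinite_finite_induct)
     (simp_all only: shift_distribs sum.infinite sum.empty sum.insert prod.infinite prod.empty prod.insert
       simp_thms)

lemma shift_prod: "shift (prod f A) = (\<Prod>a\<in>A. shift (f a))"
  by (induction A rule: infinite_finite_induct)
     (simp_all only: shift_distribs sum.infinite sum.empty sum.insert prod.infinite prod.empty prod.insert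
       simp_thms)

lemma dmono_eval_shift: "dmono_eval x (dmono_shift m) = shift (dmono_eval x m)"
proof -
  have "dmono_eval x (dmono_shift m) =
      (\<Prod>(i, j)\<in>Poly_Mapping.keys m. shift ((shift ^^ j) (x i)) ^ Poly_Mapping.lookup m (i, j))"
    by (simp add: dmono_shift_def dmono_eval_sum case_prod_unfold dmono_eval_single)
  then show ?thesis
    by (simp add: dmono_eval_def shift_prod shift_power case_prod_unfold)
qed

lemma dpoly_eval_shift: "dpoly_eval x (dpoly_shift f) = shift (dpoly_eval x f)"
proof -
  have "dpoly_eval x (dpoly_shift f) =
      (\<Sum>m\<in>Poly_Mapping.keys f. (\<lambda>_. Poly_Mapping.lookup f m) * shift (dmono_eval x m))"
    by (simp add: dpoly_shift_def dpoly_eval_sum dpoly_eval_single dmono_eval_shift)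
  then show ?thesis
    by (simp add: dpoly_eval_def shift_sum shift_distribs)
qed

theorem dpoly_eval_morphism: "diff_alg_morphism k0 n x (dpoly_eval x)"
proof -
  have "dpoly_eval x (dconst c) = (\<lambda>_. c)" for c
    by (auto simp: dconst_def dpoly_eval_single fun_eq_iff)
  moreover have "dpoly_eval x (dvar i 0) = x i" for i
    by (auto simp: dvar_def dpoly_eval_single dmono_eval_single fun_eq_iff)
  ultimately show ?thesis
    by (simp add: diff_alg_morphism_def dpoly_eval_add dpoly_eval_mult dpoly_eval_shift)
qed

theorem dpoly_morphism_unique:
  assumes k0: "subfield k0 real_field" and \<phi>: "diff_alg_morphism k0 n x \<phi>"
    and f: "f \<in> dpolys k0 n"
  shows "\<phi> f = dpoly_eval x f"
proof -
  note single = dpolys_single[OF k0]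
  note k0_01 = subfield_real_0[OF k0] subfield_real_1[OF k0]
  have add: "\<phi> (f + g) = \<phi> f + \<phi> g" and mult: "\<phi> (f * g) = \<phi> f * \<phi> g"
    if "f \<in> dpolys k0 n" "g \<in> dpolys k0 n" for f g
    using \<phi> that by (auto simp: diff_alg_morphism_def)
  have const: "\<phi> (dconst c) = (\<lambda>_. c)" if "c \<in> k0" for c
    using \<phi> that by (auto simp: diff_alg_morphism_def)
  have const_in: "dconst c \<in> dpolys k0 n" if "c \<in> k0" for c
    unfolding dconst_def by (rule single) (use that in auto)
  have zero: "\<phi> 0 = 0" and one: "\<phi> 1 = 1"
    using const[of 0] const[of 1] k0_01 by (auto simp: dconst_def fun_eq_iff)
  have var_in: "dvar i j \<in> dpolys k0 n" if "i < n" for i j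
    unfolding dvar_def by (rule single) (use k0_01 that in auto)
  have var: "\<phi> (dvar i j) = (shift ^^ j) (x i)" if "i < n" for i j
  proof (induction j)
    case 0
    then show ?case using \<phi> that by (auto simp: diff_alg_morphism_def)
  next
    case (Suc j)
    have "dpoly_shift (dvar i j) = dvar i (Suc j)"
      by (simp add: dpoly_shift_def dmono_shift_def dvar_def)
    moreover have "\<phi> (dpoly_shift (dvar i j)) = shift (\<phi> (dvar i j))"
      using \<phi> var_in[OF that] by (auto simp: diff_alg_morphism_def)
    ultimately show ?case using Suc by simp
  qed
  have pow: "Poly_Mapping.single (Poly_Mapping.single (i, j) e) 1 \<in> dpolys k0 n \<and>
      \<phi> (Poly_Mapping.single (Poly_Mapping.single (i, j) e) 1) = (shift ^^ j) (x i) ^ e"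
    if "i < n" for i j e
  proof (induction e)
    case 0
    have "dconst 1 \<in> dpolys k0 n" using const_in k0_01 by blast
    then show ?case using one by (simp add: dconst_def)
  next
    case (Suc e)
    have "Poly_Mapping.single (Poly_Mapping.single (i, j) (Suc e)) 1 =
        dvar i j * Poly_Mapping.single (Poly_Mapping.single (i, j) e) 1"
      by (simp add: dvar_def mult_single single_add[symmetric])
    moreover have "Poly_Mapping.single (Poly_Mapping.single (i, j) (Suc e)) 1 \<in> dpolys k0 n"
      by (rule single) (use k0_01 that in auto)
    ultimately show ?case
      using Suc mult[OF var_in[OF that]] var[OF that] by simp
  qed
  have mono_aux: "\<phi> (Poly_Mapping.single (\<Sum>v\<in>A. Poly_Mapping.single v (e v)) 1) =
      dmono_eval x (\<Sum>v\<in>A. Poly_Mapping.single v (e v))"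
    if "finite A" "\<forall>(i, j)\<in>A. i < n" for A :: "(nat \<times> nat) set" and e
    using that
  proof (induction A rule: finite_induct)
    case empty
    then show ?case using one by simp
  next
    case (insert v A)
    obtain i j where v: "v = (i, j)" by (cases v)
    with insert.prems have i: "i < n" by simp
    let ?m = "\<Sum>v\<in>A. Poly_Mapping.single v (e v)"
    have "Poly_Mapping.single (\<Sum>v\<in>insert v A. Poly_Mapping.single v (e v)) (1::real) =
        Poly_Mapping.single (Poly_Mapping.single (i, j) (e v)) 1 * Poly_Mapping.single ?m 1"
      using insert.hyps v by (simp add: mult_single)
    moreover have "Poly_Mapping.single ?m 1 \<in> dpolys k0 n"
    proof (rule single)
      show "\<forall>(i, j)\<in>Poly_Mapping.keys ?m. i < n"
        using Poly_Mapping.keys_sum[of "\<lambda>v. Poly_Mapping.single v (e v)" A] insert.prems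
        by (fastforce split: if_splits)
    qed (use k0_01 in auto)
    ultimately show ?case
      using insert mult pow[OF i, of j "e v"] v
      by (simp add: dmono_eval_add dmono_eval_single)
  qed
  have mono: "\<phi> (Poly_Mapping.single m c) = dpoly_eval x (Poly_Mapping.single m c)"
    if "c \<in> k0" and m: "\<forall>(i, j)\<in>Poly_Mapping.keys m. i < n" for m c
  proof -
    have "Poly_Mapping.single m c = dconst c * Poly_Mapping.single m 1"
      by (simp add: dconst_def mult_single)
    moreover have "\<phi> (Poly_Mapping.single m 1) = dmono_eval x m"
      using mono_aux[OF finite_keys m, of "Poly_Mapping.lookup m"] poly_mapping_sum_single[of m] by simp
    moreover have "Poly_Mapping.single m 1 \<in> dpolys k0 n"
      by (rule single) (use k0_01 m in auto)
    ultimately show ?thesis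
      using mult[OF const_in[OF that(1)]] const[OF that(1)]
      by (metis dpoly_eval_single)
  qed
  have "\<phi> (\<Sum>m\<in>A. Poly_Mapping.single m (Poly_Mapping.lookup f m)) =
      dpoly_eval x (\<Sum>m\<in>A. Poly_Mapping.single m (Poly_Mapping.lookup f m))"
    if "finite A" "A \<subseteq> Poly_Mapping.keys f" for A
    using that
  proof (induction A rule: finite_induct)
    case empty
    then show ?case using zero by simp
  next
    case (insert m A)
    have in_dpolys: "Poly_Mapping.single l (Poly_Mapping.lookup f l) \<in> dpolys k0 n" if "l \<in> Poly_Mapping.keys f" for l
      by (rule single) (use f that in \<open>auto simp: dpolys_def\<close>)
    have "(\<Sum>l\<in>A. Poly_Mapping.single l (Poly_Mapping.lookup f l)) \<in> dpolys k0 n"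
      by (rule dpolys_sum[OF k0]) (use in_dpolys insert.prems in auto)
    moreover have "\<phi> (Poly_Mapping.single m (Poly_Mapping.lookup f m)) =
        dpoly_eval x (Poly_Mapping.single m (Poly_Mapping.lookup f m))"
      by (rule mono) (use f insert.prems in \<open>auto simp: dpolys_def\<close>)
    ultimately show ?case
      using insert add in_dpolys[of m] by (simp add: dpoly_eval_add)
  qed
  from this[OF finite_keys order.refl] show ?thesis
    using poly_mapping_sum_single[of f] by simp
qed


subsection \<open>Inputs denote exactly the finite systems, and their codes are unambiguous\<close>

theorem dsystems_complete:
  assumes "finite F" "F \<subseteq> dpolys k0 n"
  shows "\<exists>fs. (n, fs) \<in> dsystems k0 \<and> polys_of fs = F"
proof -
  have mono: "\<exists>ps. set ps = (\<lambda>v. (v, Poly_Mapping.lookup m v)) ` Poly_Mapping.keys m \<and> mono_of ps = m" for m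
  proof -
    obtain vs where "distinct vs" "set vs = Poly_Mapping.keys m"
      using finite_distinct_list[of "Poly_Mapping.keys m"] by auto
    then have "mono_of (map (\<lambda>v. (v, Poly_Mapping.lookup m v)) vs) = m"
      using poly_mapping_sum_single[of m]
      by (simp add: mono_of_def o_def sum_list_distinct_conv_sum_set)
    with \<open>set vs = Poly_Mapping.keys m\<close> show ?thesis
      by (intro exI[of _ "map (\<lambda>v. (v, Poly_Mapping.lookup m v)) vs"]) auto
  qed
  then obtain rep where rep: "set (rep m) = (\<lambda>v. (v, Poly_Mapping.lookup m v)) ` Poly_Mapping.keys m" "mono_of (rep m) = m"
    for m by metis
  have poly: "\<exists>ts. (\<forall>(c, ps)\<in>set ts. c \<in> k0 \<and> (\<forall>((i, j), e)\<in>set ps. i < n)) \<and> poly_of ts = f"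
    if f: "f \<in> dpolys k0 n" for f
  proof -
    obtain ms where ms: "distinct ms" "set ms = Poly_Mapping.keys f"
      using finite_distinct_list[of "Poly_Mapping.keys f"] by auto
    let ?ts = "map (\<lambda>m. (Poly_Mapping.lookup f m, rep m)) ms"
    have "poly_of ?ts = f"
      using ms poly_mapping_sum_single[of f]
      by (simp add: poly_of_def o_def sum_list_distinct_conv_sum_set rep)
    moreover have "\<forall>(c, ps)\<in>set ?ts. c \<in> k0 \<and> (\<forall>((i, j), e)\<in>set ps. i < n)"
      using f ms by (fastforce simp: dpolys_def rep)
    ultimately show ?thesis by blast
  qed
  obtain fl where fl: "set fl = F" using assms(1) finite_list by blast
  have "\<forall>f\<in>F. \<exists>ts. (\<forall>(c, ps)\<in>set ts. c \<in> k0 \<and> (\<forall>((i, j), e)\<in>set ps. i < n)) \<and> poly_of ts = f"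
    using poly assms(2) by blast
  from bchoice[OF this] obtain p where
    p: "\<forall>f\<in>F. (\<forall>(c, ps)\<in>set (p f). c \<in> k0 \<and> (\<forall>((i, j), e)\<in>set ps. i < n)) \<and> poly_of (p f) = f" ..
  have "(n, map p fl) \<in> dsystems k0"
    using p fl by (simp add: dsystems_def)
  moreover have "polys_of (map p fl) = F"
    using p fl by (simp add: polys_of_def image_image)
  ultimately show ?thesis by blast
qed

theorem dsystems_sound:
  assumes "subfield k0 real_field" "(n, fs) \<in> dsystems k0"
  shows "finite (polys_of fs)" "polys_of fs \<subseteq> dpolys k0 n"
proof -
  show "finite (polys_of fs)" by (simp add: polys_of_def)
  have mono: "\<forall>(i, j)\<in>Poly_Mapping.keys (mono_of ps). i < n" if "\<forall>((i, j), e)\<in>set ps. i < n" for ps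
    using that
  proof (induction ps)
    case (Cons p ps)
    obtain i j e where p: "p = ((i, j), e)" by (cases p) auto
    have "Poly_Mapping.keys (mono_of (p # ps)) \<subseteq> Poly_Mapping.keys (Poly_Mapping.single (i, j) e) \<union> Poly_Mapping.keys (mono_of ps)"
      unfolding mono_of_def p list.map sum_list.Cons prod.case by (rule keys_add)
    with Cons p show ?case by (fastforce split: if_splits)
  qed (simp add: mono_of_def)
  have "poly_of ts \<in> dpolys k0 n"
    if "\<forall>(c, ps)\<in>set ts. c \<in> k0 \<and> (\<forall>((i, j), e)\<in>set ps. i < n)" for ts
    using that
  proof (induction ts)
    case Nil
    then show ?case
      using subfield_real_0[OF assms(1)] by (simp add: poly_of_def dpolys_def)
  next
    case (Cons t ts)
    obtain c ps where t: "t = (c, ps)" by (cases t)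
    have "Poly_Mapping.single (mono_of ps) c \<in> dpolys k0 n"
      by (rule dpolys_single[OF assms(1)]) (use Cons.prems t mono in auto)
    moreover have "poly_of ts \<in> dpolys k0 n" using Cons by simp
    ultimately have "Poly_Mapping.single (mono_of ps) c + poly_of ts \<in> dpolys k0 n"
      by (rule dpolys_add[OF assms(1)])
    then show ?case by (simp add: t poly_of_def)
  qed
  then show "polys_of fs \<subseteq> dpolys k0 n"
    using assms(2) by (auto simp: polys_of_def dsystems_def)
qed

theorem dsys_code_inj:
  assumes "inj_on \<nu> k0"
  shows "inj_on (dsys_code \<nu>) (dsystems k0)"
proof -
  have list_inj: "inj_on (\<lambda>xs. list_encode (map g xs)) (lists A)" if "inj_on g A"
    for g :: "'a \<Rightarrow> nat" and A
  proof (rule inj_onI)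
    fix xs ys assume "xs \<in> lists A" "ys \<in> lists A" "list_encode (map g xs) = list_encode (map g ys)"
    then show "xs = ys"
      using inj_onD[OF inj_on_mapI[OF inj_on_subset[OF that]], of "{xs, ys}" xs ys]
      by (simp add: list_encode_eq in_lists_conv_set subset_iff)
  qed
  have pow_inj: "inj (\<lambda>(v, e). prod_encode (prod_encode v, e))"
    by (rule injI) (simp add: split_paired_all)
  have pows_inj: "ps = qs"
    if "list_encode (map (\<lambda>(v, e). prod_encode (prod_encode v, e)) ps) =
      list_encode (map (\<lambda>(v, e). prod_encode (prod_encode v, e)) qs)" for ps qs
    using inj_onD[OF list_inj[OF pow_inj] that] by simp
  have term_inj: "inj_on (term_code \<nu>) (k0 \<times> UNIV)"
  proof (rule inj_onI)
    fix s t :: dterm assume st: "s \<in> k0 \<times> UNIV" "t \<in> k0 \<times> UNIV" "term_code \<nu> s = term_code \<nu> t"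
    obtain c ps d qs where eqs: "s = (c, ps)" "t = (d, qs)" by (cases s, cases t)
    have "\<nu> c = \<nu> d" "ps = qs"
      using st(3) by (simp_all add: eqs term_code_def pows_inj)
    then show "s = t"
      using inj_onD[OF assms, of c d] st(1,2) by (simp add: eqs)
  qed
  show ?thesis
  proof (rule inj_onI)
    fix S T :: dsys assume ST: "S \<in> dsystems k0" "T \<in> dsystems k0" "dsys_code \<nu> S = dsys_code \<nu> T"
    obtain n fs n' gs where eqs: "S = (n, fs)" "T = (n', gs)" by (cases S, cases T)
    have "fs \<in> lists (lists (k0 \<times> UNIV))" "gs \<in> lists (lists (k0 \<times> UNIV))"
      using ST(1,2) by (auto simp: eqs dsystems_def in_lists_conv_set)
    moreover have "n = n'" "list_encode (map (\<lambda>ts. list_encode (map (term_code \<nu>) ts)) fs) =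
        list_encode (map (\<lambda>ts. list_encode (map (term_code \<nu>) ts)) gs)"
      using ST(3) by (simp_all add: eqs dsys_code_def)
    ultimately show "S = T"
      using inj_onD[OF list_inj[OF list_inj[OF term_inj]], of fs gs] by (simp add: eqs)
  qed
qed

end

theory Submission
  imports Defs
begin

text \<open>
  Every partial recursive function is computed by a nondeterministic register program, hence by a
  finite automaton acting on finitely many registers.  Over the reals, finite conjunctions and
  disjunctions of polynomial equations are again single equations (sums of squares and products),
  so "two consecutive values of the unknowns are related by a transition of the automaton, or the
  automaton has just accepted and is restarted with its input" is one difference equation.

  There is no way to single out an initial index, so restarts have to be forced: an additional
  unknown \<open>t\<close> satisfies \<open>t = 1 + \<sigma>(t)\<^sup>2\<close> except at restarts.  Along such a stretch \<open>t\<close> is nonnegative and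
  drops by at least \<open>3/4\<close> in each step, so the stretch is finite; conversely, any length occurs, with
  the integers \<open>0, 1, 2, 5, 26, \<dots>\<close> read backwards.  Hence the system is solvable if and only if the program
  halts: between two restarts there is an accepting run, and an accepting run yields a periodic
  solution, over both index sets and over every subfield.

  Two further equations \<open>X\<^sub>0 = a\<close> and \<open>X\<^sub>1 = b\<close> supply the input.  As the code of a system is obtained
  from these two numbers and the code of the remaining system by pairing, a diagonal argument applies to
  systems directly, and no universal machine is needed.
\<close>

section \<open>Nondeterministic register programs\<close>

datatype atom = Lin nat nat nat nat | Test nat nat

datatype prog = Atom atom | Seq prog prog | Star prog

type_synonym regs = "nat \<Rightarrow> nat"

fun act :: "atom \<Rightarrow> regs rel" where
  "act (Lin x a y b) = {(s, s'). s' = s(x := a * s y + b)}"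
| "act (Test x y) = {(s, s'). s' = s \<and> s x = s y}"

fun exec :: "prog \<Rightarrow> regs rel" where
  "exec (Atom a) = act a"
| "exec (Seq c d) = exec c O exec d"
| "exec (Star c) = (exec c)\<^sup>*"

text \<open>The arguments are in the registers \<open>xs\<close>, the result goes to \<open>out\<close>, and the registers from \<open>N\<close>
  on are scratch space.\<close>

definition computes :: "recf \<Rightarrow> nat list \<Rightarrow> nat \<Rightarrow> nat \<Rightarrow> prog \<Rightarrow> bool" where
  "computes f xs out N c \<longleftrightarrow>
     (\<forall>s s'. (s, s') \<in> exec c \<longrightarrow> rec_eval f (map s xs) (s' out) \<and> (\<forall>v<N. v \<noteq> out \<longrightarrow> s' v = s v)) \<and>
     (\<forall>s y. rec_eval f (map s xs) y \<longrightarrow> (\<exists>s'. (s, s') \<in> exec c \<and> s' out = y))"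

text \<open>All registers are arbitrary, so that a larger program can place a subprogram on its own
  scratch space. As \<open>out\<close> is not an argument, an execution leaves the arguments intact
  and can be repeated in a loop.\<close>

definition compilable :: "recf \<Rightarrow> bool" where
  "compilable f \<longleftrightarrow> (\<forall>xs out N. (\<forall>x\<in>set xs. x < N \<and> x \<noteq> out) \<longrightarrow> out < N \<longrightarrow> (\<exists>c. computes f xs out N c))"

lemma compilableD:
  assumes "compilable f" "\<forall>x\<in>set xs. x < N \<and> x \<noteq> out" "out < N"
  obtains c where
    "\<And>s s'. (s, s') \<in> exec c \<Longrightarrow> rec_eval f (map s xs) (s' out)"
    "\<And>s s' v. (s, s') \<in> exec c \<Longrightarrow> v < N \<Longrightarrow> v \<noteq> out \<Longrightarrow> s' v = s v"
    "\<And>s y. rec_eval f (map s xs) y \<Longrightarrow> \<exists>s'. (s, s') \<in> exec c \<and> s' out = y"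
proof -
  obtain c where "computes f xs out N c"
    using assms(1)[unfolded compilable_def, rule_format, of xs N out] assms(2,3) by blast
  then show thesis
    by (intro that[of c]) (simp_all add: computes_def)
qed

text \<open>On argument lists of the wrong length a function such as \<open>Succ_rf\<close> has no
  values. A program without executions computes it there, and only the other lists need a
  construction.\<close>

lemma compilableI:
  assumes "\<And>xs out N. \<forall>x\<in>set xs. x < N \<and> x \<noteq> out \<Longrightarrow> out < N \<Longrightarrow>
    (\<forall>ys y. length ys = length xs \<longrightarrow> \<not> rec_eval f ys y) \<or> (\<exists>c. computes f xs out N c)"
  shows "compilable f"
  unfolding compilable_def
proof (intro allI impI)
  fix xs :: "nat list" and out N
  assume "\<forall>x\<in>set xs. x < N \<and> x \<noteq> out" "out < N"
  then consider "\<forall>ys y. length ys = length xs \<longrightarrow> \<not> rec_eval f ys y" | "\<exists>c. computes f xs out N c"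
    using assms by metis
  then show "\<exists>c. computes f xs out N c"
  proof cases
    case 1
    let ?fail = "Seq (Atom (Lin 0 0 0 0)) (Seq (Atom (Lin 1 0 0 1)) (Atom (Test 0 1)))"
    have "exec ?fail = {}" by auto
    with 1 have "computes f xs out N ?fail" by (simp add: computes_def)
    then show ?thesis ..
  qed
qed

section \<open>Programs for the constructors of partial recursive functions\<close>

lemma compilable_Zero: "compilable Zero_rf"
proof (intro compilableI disjI2 exI)
  show "computes Zero_rf xs out N (Atom (Lin out 0 0 0))" for xs out N
    by (auto simp: computes_def intro: rec_eval.zero elim: rec_eval_elims)
qed

lemma compilable_Succ: "compilable Succ_rf"
proof (rule compilableI)
  fix xs :: "nat list" and out N
  assume xs: "\<forall>x\<in>set xs. x < N \<and> x \<noteq> out" "out < N"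
  show "(\<forall>ys y. length ys = length xs \<longrightarrow> \<not> rec_eval Succ_rf ys y) \<or> (\<exists>c. computes Succ_rf xs out N c)"
  proof (cases "\<exists>x. xs = [x]")
    case True
    then obtain x where "xs = [x]" ..
    then have "computes Succ_rf xs out N (Atom (Lin out 1 x 1))"
      by (auto simp: computes_def intro: rec_eval.succ elim: rec_eval_elims)
    then show ?thesis by blast
  next
    case False
    then have "length xs \<noteq> 1" by (auto simp: length_Suc_conv)
    then show ?thesis by (auto elim: rec_eval_elims)
  qed
qed

lemma compilable_Proj: "compilable (Proj_rf i)"
proof (rule compilableI)
  fix xs :: "nat list" and out N
  assume xs: "\<forall>x\<in>set xs. x < N \<and> x \<noteq> out" "out < N"
  show "(\<forall>ys y. length ys = length xs \<longrightarrow> \<not> rec_eval (Proj_rf i) ys y) \<or> (\<exists>c. computes (Proj_rf i) xs out N c)"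
  proof (cases "i < length xs")
    case True
    then have "rec_eval (Proj_rf i) (map s xs) y \<longleftrightarrow> y = s (xs ! i)" for s y
      using rec_eval.proj[of i "map s xs"] by (auto elim: rec_eval_elims)
    then have "computes (Proj_rf i) xs out N (Atom (Lin out 1 (xs ! i) 0))"
      by (auto simp: computes_def)
    then show ?thesis by blast
  next
    case False
    then show ?thesis by (auto elim: rec_eval_elims)
  qed
qed

definition computes_list :: "recf list \<Rightarrow> nat list \<Rightarrow> nat \<Rightarrow> prog \<Rightarrow> bool" where
  "computes_list gs xs N c \<longleftrightarrow>
     (\<forall>s s'. (s, s') \<in> exec c \<longrightarrow>
        list_all2 (\<lambda>g y. rec_eval g (map s xs) y) gs (map s' [N..<N + length gs]) \<and> (\<forall>v<N. s' v = s v)) \<and>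
     (\<forall>s ys. list_all2 (\<lambda>g y. rec_eval g (map s xs) y) gs ys \<longrightarrow>
        (\<exists>s'. (s, s') \<in> exec c \<and> map s' [N..<N + length gs] = ys))"

text \<open>The results go to consecutive scratch registers. After each function the bound is raised
  past the result just stored, so later programs cannot overwrite it.\<close>

lemma compilable_list:
  assumes "\<forall>g\<in>set gs. compilable g" "\<forall>x\<in>set xs. x < N"
  shows "\<exists>c. computes_list gs xs N c"
  using assms
proof (induction gs arbitrary: N)
  case Nil
  show ?case
    \<comment> \<open>Copying a register to itself serves as the empty program.\<close>
    by (rule exI[of _ "Atom (Lin N 1 N 0)"]) (auto simp: computes_list_def fun_upd_idem)
next
  case (Cons g gs)
  have up: "[N..<N + length (g # gs)] = N # [Suc N..<Suc N + length gs]"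
    by (simp add: upt_conv_Cons del: upt_Suc)
  obtain c where c:
    "\<And>s s'. (s, s') \<in> exec c \<Longrightarrow> rec_eval g (map s xs) (s' N)"
    "\<And>s s' v. (s, s') \<in> exec c \<Longrightarrow> v < Suc N \<Longrightarrow> v \<noteq> N \<Longrightarrow> s' v = s v"
    "\<And>s y. rec_eval g (map s xs) y \<Longrightarrow> \<exists>s'. (s, s') \<in> exec c \<and> s' N = y"
  proof -
    have "compilable g" using Cons.prems(1) by simp
    from this[unfolded compilable_def, rule_format, of xs "Suc N" N] Cons.prems(2)
    obtain c where "computes g xs N (Suc N) c" by (auto simp: less_Suc_eq)
    then show thesis by (intro that[of c]) (simp_all add: computes_def)
  qed
  obtain d where d:
    "\<And>s s'. (s, s') \<in> exec d \<Longrightarrow>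
        list_all2 (\<lambda>g y. rec_eval g (map s xs) y) gs (map s' [Suc N..<Suc N + length gs])"
    "\<And>s s' v. (s, s') \<in> exec d \<Longrightarrow> v < Suc N \<Longrightarrow> s' v = s v"
    "\<And>s ys. list_all2 (\<lambda>g y. rec_eval g (map s xs) y) gs ys \<Longrightarrow>
        \<exists>s'. (s, s') \<in> exec d \<and> map s' [Suc N..<Suc N + length gs] = ys"
  proof -
    have "\<forall>x\<in>set xs. x < Suc N" using Cons.prems(2) by (simp add: less_SucI)
    with Cons.IH[of "Suc N"] Cons.prems(1) obtain d where "computes_list gs xs (Suc N) d" by auto
    then show thesis by (intro that[of d]) (simp_all add: computes_list_def)
  qed
  have keep: "map s' xs = map s xs" if "(s, s') \<in> exec c" for s s'
    using c(2)[OF that] Cons.prems(2) by (auto simp: less_Suc_eq)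
  have "computes_list (g # gs) xs N (Seq c d)"
    unfolding computes_list_def
  proof (intro conjI allI impI)
    fix s s' assume "(s, s') \<in> exec (Seq c d)"
    then obtain s1 where s1: "(s, s1) \<in> exec c" "(s1, s') \<in> exec d" by auto
    show "list_all2 (\<lambda>g y. rec_eval g (map s xs) y) (g # gs) (map s' [N..<N + length (g # gs)])"
      unfolding up using c(1)[OF s1(1)] d(1)[OF s1(2)] d(2)[OF s1(2), of N] keep[OF s1(1)]
      by simp
    show "s' v = s v" if "v < N" for v
      using c(2)[OF s1(1)] d(2)[OF s1(2)] that by simp
  next
    fix s ys assume "list_all2 (\<lambda>g y. rec_eval g (map s xs) y) (g # gs) ys"
    then obtain y zs where ys: "ys = y # zs" "rec_eval g (map s xs) y"
      "list_all2 (\<lambda>g y. rec_eval g (map s xs) y) gs zs" by (auto simp: list_all2_Cons1)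
    from c(3)[OF ys(2)] obtain s1 where s1: "(s, s1) \<in> exec c" "s1 N = y" by blast
    from ys(3) have "list_all2 (\<lambda>g y. rec_eval g (map s1 xs) y) gs zs"
      unfolding keep[OF s1(1)] .
    from d(3)[OF this] obtain s' where
      s': "(s1, s') \<in> exec d" "map s' [Suc N..<Suc N + length gs] = zs" by blast
    have "s' N = y" using d(2)[OF s'(1), of N] s1(2) by simp
    with s' s1 ys(1) show "\<exists>s'. (s, s') \<in> exec (Seq c d) \<and> map s' [N..<N + length (g # gs)] = ys"
      unfolding up by auto
  qed
  then show ?case ..
qed

lemma compilable_Comp:
  assumes f: "compilable f" and gs: "\<forall>g\<in>set gs. compilable g"
  shows "compilable (Comp_rf f gs)"
proof (intro compilableI disjI2)
  fix xs :: "nat list" and out N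
  assume xs: "\<forall>x\<in>set xs. x < N \<and> x \<noteq> out" and out: "out < N"
  let ?ys = "[N..<N + length gs]"
  obtain d where d:
    "\<And>s s'. (s, s') \<in> exec d \<Longrightarrow> list_all2 (\<lambda>g y. rec_eval g (map s xs) y) gs (map s' ?ys)"
    "\<And>s s' v. (s, s') \<in> exec d \<Longrightarrow> v < N \<Longrightarrow> s' v = s v"
    "\<And>s ys. list_all2 (\<lambda>g y. rec_eval g (map s xs) y) gs ys \<Longrightarrow> \<exists>s'. (s, s') \<in> exec d \<and> map s' ?ys = ys"
  proof -
    obtain d where "computes_list gs xs N d" using compilable_list[OF gs, of xs N] xs by blast
    then show thesis by (intro that[of d]) (simp_all add: computes_list_def)
  qed
  obtain c where c:
    "\<And>s s'. (s, s') \<in> exec c \<Longrightarrow> rec_eval f (map s ?ys) (s' out)"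
    "\<And>s s' v. (s, s') \<in> exec c \<Longrightarrow> v < N + length gs \<Longrightarrow> v \<noteq> out \<Longrightarrow> s' v = s v"
    "\<And>s y. rec_eval f (map s ?ys) y \<Longrightarrow> \<exists>s'. (s, s') \<in> exec c \<and> s' out = y"
    using f out by (elim compilableD[of f ?ys "N + length gs" out]) auto
  have "computes (Comp_rf f gs) xs out N (Seq d c)"
    unfolding computes_def
  proof (intro conjI allI impI)
    fix s s' assume "(s, s') \<in> exec (Seq d c)"
    then obtain s1 where s1: "(s, s1) \<in> exec d" "(s1, s') \<in> exec c" by auto
    show "rec_eval (Comp_rf f gs) (map s xs) (s' out)"
      using d(1)[OF s1(1)] c(1)[OF s1(2)] by (rule rec_eval.comp)
    show "s' v = s v" if "v < N" "v \<noteq> out" for v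
      using d(2)[OF s1(1)] c(2)[OF s1(2)] that by simp
  next
    fix s y assume "rec_eval (Comp_rf f gs) (map s xs) y"
    then obtain ys where "list_all2 (\<lambda>g y. rec_eval g (map s xs) y) gs ys" "rec_eval f ys y"
      by (rule rec_eval_elims) blast
    with d(3) c(3) show "\<exists>s'. (s, s') \<in> exec (Seq d c) \<and> s' out = y"
      by (metis exec.simps(2) relcomp.relcompI)
  qed
  then show "\<exists>c. computes (Comp_rf f gs) xs out N c" ..
qed

text \<open>The recursion is a loop with counter \<open>i\<close> and accumulator \<open>y\<close>.
  \<open>Star\<close> guesses the number of rounds, and the test of \<open>i\<close> against
  \<open>m\<close> after the loop rejects every wrong guess.\<close>

lemma compilable_Prim:
  assumes f: "compilable f" and g: "compilable g"
  shows "compilable (Prim_rf f g)"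
proof (rule compilableI)
  fix xs :: "nat list" and out N
  assume xs: "\<forall>x\<in>set xs. x < N \<and> x \<noteq> out" and out: "out < N"
  show "(\<forall>ys y. length ys = length xs \<longrightarrow> \<not> rec_eval (Prim_rf f g) ys y) \<or>
    (\<exists>c. computes (Prim_rf f g) xs out N c)"
  proof (cases xs)
    case Nil
    then show ?thesis by (auto elim: rec_eval.cases)
  next
    case (Cons m zs)
    define i y z where "i = N" and "y = N + 1" and "z = N + 2"
    note regs = i_def y_def z_def
    obtain c where c:
      "\<And>s s'. (s, s') \<in> exec c \<Longrightarrow> rec_eval f (map s zs) (s' y)"
      "\<And>s s' v. (s, s') \<in> exec c \<Longrightarrow> v < N + 3 \<Longrightarrow> v \<noteq> y \<Longrightarrow> s' v = s v"
      "\<And>s w. rec_eval f (map s zs) w \<Longrightarrow> \<exists>s'. (s, s') \<in> exec c \<and> s' y = w"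
      using f xs Cons by (elim compilableD[of f zs "N + 3" y]) (auto simp: regs)
    obtain d where d:
      "\<And>s s'. (s, s') \<in> exec d \<Longrightarrow> rec_eval g (map s (i # y # zs)) (s' z)"
      "\<And>s s' v. (s, s') \<in> exec d \<Longrightarrow> v < N + 3 \<Longrightarrow> v \<noteq> z \<Longrightarrow> s' v = s v"
      "\<And>s w. rec_eval g (map s (i # y # zs)) w \<Longrightarrow> \<exists>s'. (s, s') \<in> exec d \<and> s' z = w"
      using g xs Cons by (elim compilableD[of g "i # y # zs" "N + 3" z]) (auto simp: regs)
    define body where "body = Seq d (Seq (Atom (Lin y 1 z 0)) (Atom (Lin i 1 i 1)))"
    define prog where "prog = Seq c (Seq (Atom (Lin i 0 i 0))
      (Seq (Star body) (Seq (Atom (Test i m)) (Atom (Lin out 1 y 0)))))"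
    \<comment> \<open>The loop invariant, stated relative to the initial registers \<open>s\<close>,
      whose part below \<open>N\<close> no round changes.\<close>
    define reached where "reached s s' \<longleftrightarrow> (\<forall>v<N. s' v = s v) \<and> rec_eval (Prim_rf f g) (s' i # map s zs) (s' y)"
      for s s' :: regs
    have zs: "map s' zs = map s zs" if "\<forall>v<N. s' v = s v" for s s' :: regs
      using that xs Cons by simp
    have body: "reached s s2" if reached: "reached s s1" and b: "(s1, s2) \<in> exec body" for s s1 s2
    proof -
      from b obtain t where t: "(s1, t) \<in> exec d" and s2: "s2 = t(y := t z, i := t i + 1)"
        by (auto simp: body_def regs)
      have N: "\<forall>v<N. s1 v = s v" using reached by (simp add: reached_def)
      have ti: "t i = s1 i" "t y = s1 y" "\<forall>v<N. t v = s1 v"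
        using d(2)[OF t] by (auto simp: regs)
      have "rec_eval g (s1 i # s1 y # map s zs) (t z)"
        using d(1)[OF t] zs[OF N] by simp
      then have "rec_eval (Prim_rf f g) (Suc (s1 i) # map s zs) (t z)"
        using reached by (auto simp: reached_def intro: rec_eval.prim_Suc)
      then show ?thesis using N ti by (auto simp: s2 reached_def regs)
    qed
    have star: "reached s s2" if "(s1, s2) \<in> exec (Star body)" "reached s s1" for s s1 s2
      using that unfolding exec.simps by (induction rule: rtrancl_induct) (auto intro: body)
    have reach: "\<exists>s'. (s, s') \<in> exec c O act (Lin i 0 i 0) O exec (Star body) \<and> reached s s' \<and> s' i = k \<and> s' y = w"
      if "rec_eval (Prim_rf f g) (k # map s zs) w" for s k w
      using that
    proof (induction k arbitrary: w)
      case 0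
      then have "rec_eval f (map s zs) w" by (auto elim: rec_eval_elims)
      from c(3)[OF this] obtain t where t: "(s, t) \<in> exec c" "t y = w" by blast
      have "(s, t(i := 0)) \<in> exec c O act (Lin i 0 i 0) O exec (Star body)"
        using t(1) by auto
      moreover have "reached s (t(i := 0))"
        using c(2)[OF t(1)] t(2) 0 by (auto simp: reached_def regs)
      moreover have "(t(i := 0)) i = 0" "(t(i := 0)) y = w"
        using t(2) by (simp_all add: regs)
      ultimately show ?case by blast
    next
      case (Suc k)
      then obtain w' where w': "rec_eval (Prim_rf f g) (k # map s zs) w'" "rec_eval g (k # w' # map s zs) w"
        by (auto elim: rec_eval_elims)
      from Suc.IH[OF w'(1)] obtain s1 where s1: "(s, s1) \<in> exec c O act (Lin i 0 i 0) O exec (Star body)"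
        "reached s s1" "s1 i = k" "s1 y = w'" by blast
      have "map s1 zs = map s zs" using s1(2) by (intro zs) (simp add: reached_def)
      with w'(2) s1 d(3)[of s1 w] obtain t where t: "(s1, t) \<in> exec d" "t z = w" by auto
      let ?s2 = "t(y := t z, i := t i + 1)"
      have "(t, t(y := t z)) \<in> act (Lin y 1 z 0)" "(t(y := t z), ?s2) \<in> act (Lin i 1 i 1)"
        by (simp_all add: regs)
      then have b: "(s1, ?s2) \<in> exec body"
        using t(1) unfolding body_def exec.simps by blast
      have "(s, ?s2) \<in> exec c O act (Lin i 0 i 0) O exec (Star body)"
        using s1(1) b by (auto intro: rtrancl_into_rtrancl)
      moreover have "reached s ?s2" by (rule body[OF s1(2) b])
      moreover have "?s2 i = Suc k" "?s2 y = w"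
        using d(2)[OF t(1), of i] s1(3) t(2) by (auto simp: regs)
      ultimately show ?case by blast
    qed
    have "computes (Prim_rf f g) xs out N prog"
      unfolding computes_def
    proof (intro conjI allI impI)
      fix s s' assume "(s, s') \<in> exec prog"
      then obtain t s1 where t: "(s, t) \<in> exec c" and s1: "(t(i := 0), s1) \<in> exec (Star body)" "s1 i = s1 m"
        and s': "s' = s1(out := s1 y)"
        by (auto simp: prog_def)
      have "reached s (t(i := 0))"
        using c(1,2)[OF t] by (auto simp: reached_def regs intro: rec_eval.prim_0)
      with star[OF s1(1)] have reached: "reached s s1" by blast
      show "rec_eval (Prim_rf f g) (map s xs) (s' out)"
        using reached s1(2) xs Cons by (auto simp: reached_def s')
      show "s' v = s v" if "v < N" "v \<noteq> out" for v
        using reached that by (simp add: reached_def s')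
    next
      fix s w assume "rec_eval (Prim_rf f g) (map s xs) w"
      with Cons have "rec_eval (Prim_rf f g) (s m # map s zs) w" by simp
      from reach[OF this] obtain s1 where s1: "(s, s1) \<in> exec c O act (Lin i 0 i 0) O exec (Star body)"
        "reached s s1" "s1 i = s m" "s1 y = w" by blast
      have "s1 m = s m" using s1(2) xs Cons by (simp add: reached_def)
      with s1 have "(s, s1(out := w)) \<in> exec prog"
        by (fastforce simp: prog_def)
      then show "\<exists>s'. (s, s') \<in> exec prog \<and> s' out = w"
        by (intro exI[of _ "s1(out := w)"]) simp
    qed
    then show ?thesis by blast
  qed
qed

text \<open>The program counts \<open>m\<close> up from 0, checking each time that the value of
  \<open>f\<close> is positive, and leaves the loop at a nondeterministic moment. The final test for
  0 makes \<open>m\<close> a zero; the invariant \<open>reached\<close> supplies the positive values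
  below it that \<open>rec_eval.mini\<close> demands.\<close>

lemma compilable_Min:
  assumes f: "compilable f"
  shows "compilable (Min_rf f)"
proof (intro compilableI disjI2)
  fix xs :: "nat list" and out N
  assume xs: "\<forall>x\<in>set xs. x < N \<and> x \<noteq> out" and out: "out < N"
  define m y z where "m = N" and "y = N + 1" and "z = N + 2"
  note regs = m_def y_def z_def
  obtain c where c:
    "\<And>s s'. (s, s') \<in> exec c \<Longrightarrow> rec_eval f (map s (m # xs)) (s' y)"
    "\<And>s s' v. (s, s') \<in> exec c \<Longrightarrow> v < N + 3 \<Longrightarrow> v \<noteq> y \<Longrightarrow> s' v = s v"
    "\<And>s w. rec_eval f (map s (m # xs)) w \<Longrightarrow> \<exists>s'. (s, s') \<in> exec c \<and> s' y = w"
    using f xs by (elim compilableD[of f "m # xs" "N + 3" y]) (auto simp: regs)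
  \<comment> \<open>Tests only compare registers for equality, so positivity of \<open>y\<close> is
    certified by guessing: \<open>z\<close> starts at 1, is increased any number of times and must
    end equal to \<open>y\<close>.\<close>
  define guess where "guess = Seq (Atom (Lin z 0 z 1)) (Seq (Star (Atom (Lin z 1 z 1))) (Atom (Test y z)))"
  have guess: "(s, s') \<in> exec guess \<longleftrightarrow> s' = s(z := s y) \<and> 0 < s y" for s s'
  proof -
    have up: "(s(z := 1), s(z := Suc k)) \<in> (act (Lin z 1 z 1))\<^sup>*" for k
    proof (induction k)
      case (Suc k)
      have "(s(z := Suc k), s(z := Suc (Suc k))) \<in> act (Lin z 1 z 1)" by simp
      with Suc.IH show ?case by (rule rtrancl_into_rtrancl)
    qed simp
    have down: "\<exists>k. s1 = s(z := Suc k)" if "(s(z := 1), s1) \<in> (act (Lin z 1 z 1))\<^sup>*" for s1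
      using that
    proof (induction rule: rtrancl_induct)
      case base
      show ?case by auto
    next
      case (step t u)
      then obtain k where "t = s(z := Suc k)" by blast
      with step.hyps(2) have "u = s(z := Suc (Suc k))" by simp
      then show ?case ..
    qed
    show ?thesis
    proof
      assume "(s, s') \<in> exec guess"
      then have "(s(z := 1), s') \<in> (act (Lin z 1 z 1))\<^sup>*" and "s' y = s' z"
        by (auto simp: guess_def)
      then show "s' = s(z := s y) \<and> 0 < s y" using down[of s'] by (auto simp: regs)
    next
      assume s': "s' = s(z := s y) \<and> 0 < s y"
      then have "(s(z := 1), s') \<in> (act (Lin z 1 z 1))\<^sup>*" using up[of "s y - 1"] by simp
      moreover have "(s, s(z := 1)) \<in> act (Lin z 0 z 1)" by simp
      moreover have "(s', s') \<in> act (Test y z)" using s' by (auto simp: regs)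
      ultimately show "(s, s') \<in> exec guess" unfolding guess_def exec.simps by blast
    qed
  qed
  define body where "body = Seq c (Seq guess (Atom (Lin m 1 m 1)))"
  define prog where "prog = Seq (Atom (Lin m 0 m 0)) (Seq (Star body) (Seq c
    (Seq (Atom (Lin z 0 z 0)) (Seq (Atom (Test y z)) (Atom (Lin out 1 m 0))))))"
  define reached where "reached s s' \<longleftrightarrow> (\<forall>v<N. s' v = s v) \<and> (\<forall>l<s' m. \<exists>w. rec_eval f (l # map s xs) (Suc w))"
    for s s' :: regs
  have mxs: "map s' xs = map s xs" if "\<forall>v<N. s' v = s v" for s s' :: regs
    using that xs by simp
  have body: "reached s s2" if reached: "reached s s1" and b: "(s1, s2) \<in> exec body" for s s1 s2
  proof -
    from b obtain t where t: "(s1, t) \<in> exec c" "0 < t y" and s2: "s2 = t(z := t y, m := t m + 1)"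
      by (auto simp: body_def guess regs)
    have N: "\<forall>v<N. s1 v = s v" using reached by (simp add: reached_def)
    have tm: "t m = s1 m" "\<forall>v<N. t v = s1 v"
      using c(2)[OF t(1)] by (auto simp: regs)
    have "rec_eval f (s1 m # map s xs) (t y)"
      using c(1)[OF t(1)] mxs[OF N] by simp
    then have "\<exists>w. rec_eval f (s1 m # map s xs) (Suc w)"
      using t(2) by (metis Suc_pred)
    then show ?thesis using N tm reached by (auto simp: s2 reached_def regs less_Suc_eq)
  qed
  have star: "reached s s2" if "(s1, s2) \<in> exec (Star body)" "reached s s1" for s s1 s2
    using that unfolding exec.simps by (induction rule: rtrancl_induct) (auto intro: body)
  have reach: "\<exists>s'. (s(m := 0), s') \<in> exec (Star body) \<and> reached s s' \<and> s' m = k"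
    if "\<forall>l<k. \<exists>w. rec_eval f (l # map s xs) (Suc w)" for s k
    using that
  proof (induction k)
    case 0
    then show ?case by (intro exI[of _ "s(m := 0)"]) (auto simp: reached_def regs)
  next
    case (Suc k)
    then have "\<forall>l<k. \<exists>w. rec_eval f (l # map s xs) (Suc w)" by simp
    from Suc.IH[OF this] obtain s1 where
      s1: "(s(m := 0), s1) \<in> exec (Star body)" "reached s s1" "s1 m = k" by blast
    from Suc.prems obtain w where w: "rec_eval f (k # map s xs) (Suc w)" by blast
    have "map s1 xs = map s xs" using s1(2) by (intro mxs) (simp add: reached_def)
    with w s1 c(3)[of s1 "Suc w"] obtain t where t: "(s1, t) \<in> exec c" "t y = Suc w" by auto
    let ?s2 = "t(z := t y, m := t m + 1)"
    have "(t, t(z := t y)) \<in> exec guess" "(t(z := t y), ?s2) \<in> act (Lin m 1 m 1)"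
      using t(2) by (simp_all add: guess regs)
    then have b: "(s1, ?s2) \<in> exec body"
      using t(1) unfolding body_def exec.simps by blast
    have "(s(m := 0), ?s2) \<in> exec (Star body)"
      using s1(1) b by (auto intro: rtrancl_into_rtrancl)
    moreover have "reached s ?s2" by (rule body[OF s1(2) b])
    moreover have "?s2 m = Suc k"
      using c(2)[OF t(1), of m] s1(3) by (auto simp: regs)
    ultimately show ?case by blast
  qed
  have "computes (Min_rf f) xs out N prog"
    unfolding computes_def
  proof (intro conjI allI impI)
    fix s s' assume "(s, s') \<in> exec prog"
    then obtain s1 t where s1: "(s(m := 0), s1) \<in> exec (Star body)" and t: "(s1, t) \<in> exec c" "t y = 0"
      and s': "s' = t(z := 0, out := t m)"
      using out by (auto simp: prog_def regs)
    have "reached s (s(m := 0))"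
      by (auto simp: reached_def regs)
    with star[OF s1] have reached: "reached s s1" by blast
    have tm: "t m = s1 m" "\<forall>v<N. t v = s1 v"
      using c(2)[OF t(1)] by (auto simp: regs)
    have "map s1 xs = map s xs" using reached by (intro mxs) (simp add: reached_def)
    then have "rec_eval f (s1 m # map s xs) 0"
      using c(1)[OF t(1)] t(2) by (simp only: list.map)
    with reached have "rec_eval (Min_rf f) (map s xs) (s1 m)"
      by (intro rec_eval.mini) (auto simp: reached_def)
    then show "rec_eval (Min_rf f) (map s xs) (s' out)"
      by (simp add: s' tm)
    show "s' v = s v" if "v < N" "v \<noteq> out" for v
      using reached tm that by (simp add: reached_def s' regs)
  next
    fix s k assume "rec_eval (Min_rf f) (map s xs) k"
    then have k: "rec_eval f (k # map s xs) 0" "\<forall>l<k. \<exists>w. rec_eval f (l # map s xs) (Suc w)"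
      by (auto elim: rec_eval_elims)
    from reach[OF k(2)] obtain s1 where s1: "(s(m := 0), s1) \<in> exec (Star body)" "reached s s1" "s1 m = k"
      by blast
    have "map s1 xs = map s xs" using s1(2) by (intro mxs) (simp add: reached_def)
    with k(1) s1 c(3)[of s1 0] obtain t where t: "(s1, t) \<in> exec c" "t y = 0" by auto
    have "t m = k" using c(2)[OF t(1), of m] s1(3) by (simp add: regs)
    moreover have "(s, s(m := 0)) \<in> act (Lin m 0 m 0)" "(t, t(z := 0)) \<in> act (Lin z 0 z 0)"
      "(t(z := 0), t(z := 0)) \<in> act (Test y z)"
      "(t(z := 0), t(z := 0, out := t m)) \<in> act (Lin out 1 m 0)"
      using t(2) by (simp_all add: regs)
    then have "(s, t(z := 0, out := t m)) \<in> exec prog"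
      using s1(1) t(1) unfolding prog_def exec.simps by blast
    ultimately show "\<exists>s'. (s, s') \<in> exec prog \<and> s' out = k" by force
  qed
  then show "\<exists>c. computes (Min_rf f) xs out N c" ..
qed

theorem compilable: "compilable f"
  by (induction f)
     (auto intro: compilable_Zero compilable_Succ compilable_Proj compilable_Comp compilable_Prim compilable_Min)

section \<open>Small steps on stacks of continuations\<close>

text \<open>\<open>Test 0 0\<close> serves as the silent action.\<close>

inductive edge :: "prog list \<Rightarrow> atom \<Rightarrow> prog list \<Rightarrow> bool" where
  edge_Atom: "edge (Atom a # K) a K"
| edge_Seq: "edge (Seq c d # K) (Test 0 0) (c # d # K)"
| edge_exit: "edge (Star c # K) (Test 0 0) K"
| edge_loop: "edge (Star c # K) (Test 0 0) (c # Star c # K)"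

definition step :: "(prog list \<times> regs) rel" where
  "step = {((K, s), (K', s')). \<exists>a. edge K a K' \<and> (s, s') \<in> act a}"

fun execs :: "prog list \<Rightarrow> regs rel" where
  "execs [] = Id"
| "execs (c # K) = exec c O execs K"

text \<open>Induction from the front: each edge unfolds the head of the stack as the equations of
  \<open>exec\<close> do, so a step followed by an execution of the new stack is an execution of the
  old one.\<close>

lemma steps_imp_execs: "((K, s), ([], s')) \<in> step\<^sup>* \<Longrightarrow> (s, s') \<in> execs K"
proof (induction "(K, s)" arbitrary: K s rule: converse_rtrancl_induct)
  case (step p)
  obtain K1 s1 where p: "p = (K1, s1)" by (cases p)
  with step obtain a where a: "edge K a K1" "(s, s1) \<in> act a" and IH: "(s1, s') \<in> execs K1"
    by (auto simp: step_def)
  from a(1) show ?case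
    using a(2) IH by cases (auto intro: converse_rtrancl_into_rtrancl)
qed simp

text \<open>The remainder \<open>K\<close> is arbitrary because sequences and loops run their parts
  with a continuation still on the stack.\<close>

lemma exec_imp_steps: "(s, s') \<in> exec c \<Longrightarrow> ((c # K, s), (K, s')) \<in> step\<^sup>*"
proof (induction c arbitrary: K s s')
  case (Atom a)
  then have "((Atom a # K, s), (K, s')) \<in> step" by (auto simp: step_def intro: edge.intros)
  then show ?case ..
next
  case (Seq c d)
  from Seq.prems obtain s1 where s1: "(s, s1) \<in> exec c" "(s1, s') \<in> exec d" by auto
  have "((Seq c d # K, s), (c # d # K, s)) \<in> step" by (auto simp: step_def intro: edge.intros)
  also note Seq.IH(1)[OF s1(1), of "d # K"]
  also note Seq.IH(2)[OF s1(2), of K]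
  finally show ?case .
next
  case (Star c)
  from Star.prems have "(s, s') \<in> (exec c)\<^sup>*" by simp
  then show ?case
  proof (induction rule: converse_rtrancl_induct)
    case base
    have "((Star c # K, s'), (K, s')) \<in> step" by (auto simp: step_def intro: edge.intros)
    then show ?case ..
  next
    case (step s s1)
    have "((Star c # K, s), (c # Star c # K, s)) \<in> step" by (auto simp: step_def intro: edge.intros)
    also note Star.IH[OF step(1), of "Star c # K"]
    also note step.IH
    finally show ?case .
  qed
qed

lemma steps_iff_exec: "((([c], s), ([], s')) \<in> step\<^sup>*) \<longleftrightarrow> (s, s') \<in> exec c"
  using steps_imp_execs[of "[c]" s s'] exec_imp_steps[of s s' c "[]"] by auto

text \<open>A stack always consists of subprograms of the initial program, and only finitely many stacks
  occur: they are the control states of a finite automaton.\<close>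

fun conts :: "prog \<Rightarrow> prog list \<Rightarrow> prog list set" where
  "conts (Atom a) K = {Atom a # K, K}"
| "conts (Seq c d) K = {Seq c d # K} \<union> conts c (d # K) \<union> conts d K"
| "conts (Star c) K = {Star c # K, K} \<union> conts c (Star c # K)"

lemma finite_conts: "finite (conts c K)"
  by (induction c arbitrary: K) auto

lemma conts_ends: "c # K \<in> conts c K \<and> K \<in> conts c K"
  by (induction c arbitrary: K) auto

text \<open>Control can leave \<open>conts c K\<close> only once \<open>c\<close> has finished, that
  is, from \<open>K\<close> itself. The empty stack has no edges, so for \<open>K = []\<close> the
  set is closed.\<close>

lemma conts_closed: "L \<in> conts c K \<Longrightarrow> L = K \<or> (\<forall>a L'. edge L a L' \<longrightarrow> L' \<in> conts c K)"
proof (induction c arbitrary: K)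
  case (Atom a)
  then show ?case by (auto elim: edge.cases)
next
  case (Seq c d)
  from Seq.prems consider "L = Seq c d # K" | "L \<in> conts c (d # K)" | "L \<in> conts d K" by auto
  then show ?case
  proof cases
    case 1
    then show ?thesis using conts_ends[of c "d # K"] by (auto elim: edge.cases)
  next
    case 2
    then show ?thesis using Seq.IH(1)[OF 2] Seq.IH(2)[of K] conts_ends[of d K] by auto
  next
    case 3
    from Seq.IH(2)[OF 3] show ?thesis by auto
  qed
next
  case (Star c)
  have *: "L' \<in> conts (Star c) K" if "edge (Star c # K) a L'" for a L'
    using that conts_ends[of c "Star c # K"] by (auto elim: edge.cases)
  from Star.prems consider "L = Star c # K" | "L = K" | "L \<in> conts c (Star c # K)" by auto
  then show ?case
  proof cases
    case 3
    from Star.IH[OF 3] * show ?thesis by auto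
  qed (use * in auto)
qed

lemma conts_edge: "L \<in> conts c [] \<Longrightarrow> edge L a L' \<Longrightarrow> L' \<in> conts c []"
  using conts_closed[of L c "[]"] by (auto elim: edge.cases)

text \<open>Every stack has at most two outgoing edges. Finiteness allows the disjunction over all
  transitions to be a single polynomial.\<close>

lemma finite_edges:
  assumes "finite S"
  shows "finite {(K, a, K'). K \<in> S \<and> edge K a K'}"
proof -
  have "finite {(a, K'). edge K a K'}" for K
  proof (cases K)
    case Nil
    then have "{(a, K'). edge K a K'} = {}" by (auto elim: edge.cases)
    then show ?thesis by (simp only: finite.emptyI)
  next
    case (Cons c L)
    have "{(a, K'). edge K a K'} \<subseteq> (case c of Atom a \<Rightarrow> {(a, L)} | Seq d e \<Rightarrow> {(Test 0 0, d # e # L)}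
        | Star d \<Rightarrow> {(Test 0 0, L), (Test 0 0, d # Star d # L)})"
      unfolding Cons by (auto elim: edge.cases)
    then show ?thesis by (rule finite_subset) (simp split: prog.split)
  qed
  moreover have "{(K, a, K'). K \<in> S \<and> edge K a K'} = Sigma S (\<lambda>K. {(a, K'). edge K a K'})" by auto
  ultimately show ?thesis using assms by simp
qed

section \<open>Polynomial relations between consecutive values\<close>

lemma dpolys_mult:
  assumes k0: "subfield k0 real_field" and f: "f \<in> dpolys k0 n" and g: "g \<in> dpolys k0 n"
  shows "f * g \<in> dpolys k0 n"
proof -
  have "a * b \<in> k0" if "a \<in> k0" "b \<in> k0" for a b
    using k0 that by (simp add: subfield_real_iff)
  moreover have "\<forall>(i, j)\<in>Poly_Mapping.keys (m + l). i < n"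
    if "m \<in> Poly_Mapping.keys f" "l \<in> Poly_Mapping.keys g" for m l
    using that f g keys_add[of m l] unfolding dpolys_def by blast
  ultimately show ?thesis
    unfolding dpoly_mult_eq using f g
    by (intro dpolys_sum[OF k0] dpolys_single[OF k0]) (auto simp: dpolys_def)
qed

lemma of_nat_in_subfield: "subfield K real_field \<Longrightarrow> real m \<in> K"
  by (induction m) (simp_all add: subfield_real_0 subfield_real_1 subfield_real_add)

lemma uminus_in_subfield: "subfield K real_field \<Longrightarrow> a \<in> K \<Longrightarrow> - a \<in> K"
  using subfield_real_0[of K] by (metis diff_0 subfield_real_iff)

text \<open>In \<open>g v v'\<close>, \<open>v\<close> and \<open>v'\<close> stand for the values of all unknowns at an index and at its successor;
  the argument \<open>T\<close> fixes the index type.\<close>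

definition expressible ::
  "'m::{plus,one} itself \<Rightarrow> real set \<Rightarrow> nat \<Rightarrow> ((nat \<Rightarrow> real) \<Rightarrow> (nat \<Rightarrow> real) \<Rightarrow> real) \<Rightarrow> bool" where
  "expressible T k0 n g \<longleftrightarrow>
     (\<exists>f\<in>dpolys k0 n. \<forall>(x :: nat \<Rightarrow> 'm \<Rightarrow> real) i. dpoly_eval x f i = g (\<lambda>v. x v i) (\<lambda>v. x v (i + 1)))"

definition definable ::
  "'m::{plus,one} itself \<Rightarrow> real set \<Rightarrow> nat \<Rightarrow> ((nat \<Rightarrow> real) \<Rightarrow> (nat \<Rightarrow> real) \<Rightarrow> bool) \<Rightarrow> bool" where
  "definable T k0 n R \<longleftrightarrow> (\<exists>g. expressible T k0 n g \<and> (\<forall>v v'. R v v' \<longleftrightarrow> g v v' = 0))"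

lemma definableI:
  "expressible T k0 n g \<Longrightarrow> (\<And>v v'. R v v' \<longleftrightarrow> g v v' = 0) \<Longrightarrow> definable T k0 n R"
  unfolding definable_def by blast

context
  fixes k0 :: "real set" and n :: nat and T :: "'m::{plus,one} itself"
  assumes k0: "subfield k0 real_field"
begin

lemma expressible_const: "c \<in> k0 \<Longrightarrow> expressible T k0 n (\<lambda>v v'. c)"
  unfolding expressible_def
  by (rule bexI[of _ "Poly_Mapping.single 0 c"])
     (auto simp: dpoly_eval_single intro: dpolys_single[OF k0])

lemma expressible_now: "w < n \<Longrightarrow> expressible T k0 n (\<lambda>v v'. v w)"
  unfolding expressible_def
  by (rule bexI[of _ "Poly_Mapping.single (Poly_Mapping.single (w, 0) 1) 1"])
     (auto simp: dpoly_eval_single dmono_eval_single intro!: dpolys_single[OF k0] subfield_real_1[OF k0])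

lemma expressible_next: "w < n \<Longrightarrow> expressible T k0 n (\<lambda>v v'. v' w)"
  unfolding expressible_def
  by (rule bexI[of _ "Poly_Mapping.single (Poly_Mapping.single (w, 1) 1) 1"])
     (auto simp: dpoly_eval_single dmono_eval_single shift_def intro!: dpolys_single[OF k0] subfield_real_1[OF k0])

lemma expressible_add:
  assumes "expressible T k0 n g" "expressible T k0 n h"
  shows "expressible T k0 n (\<lambda>v v'. g v v' + h v v')"
proof -
  from assms obtain f f' where f: "f \<in> dpolys k0 n" "f' \<in> dpolys k0 n"
    "\<And>(x :: nat \<Rightarrow> 'm \<Rightarrow> real) i. dpoly_eval x f i = g (\<lambda>v. x v i) (\<lambda>v. x v (i + 1))"
    "\<And>(x :: nat \<Rightarrow> 'm \<Rightarrow> real) i. dpoly_eval x f' i = h (\<lambda>v. x v i) (\<lambda>v. x v (i + 1))"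
    unfolding expressible_def by blast
  then show ?thesis
    unfolding expressible_def
    by (intro bexI[of _ "f + f'"] dpolys_add[OF k0]) (simp_all add: dpoly_eval_add)
qed

lemma expressible_mult:
  assumes "expressible T k0 n g" "expressible T k0 n h"
  shows "expressible T k0 n (\<lambda>v v'. g v v' * h v v')"
proof -
  from assms obtain f f' where f: "f \<in> dpolys k0 n" "f' \<in> dpolys k0 n"
    "\<And>(x :: nat \<Rightarrow> 'm \<Rightarrow> real) i. dpoly_eval x f i = g (\<lambda>v. x v i) (\<lambda>v. x v (i + 1))"
    "\<And>(x :: nat \<Rightarrow> 'm \<Rightarrow> real) i. dpoly_eval x f' i = h (\<lambda>v. x v i) (\<lambda>v. x v (i + 1))"
    unfolding expressible_def by blast
  then show ?thesis
    unfolding expressible_def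
    by (intro bexI[of _ "f * f'"] dpolys_mult[OF k0]) (simp_all add: dpoly_eval_mult)
qed

lemma definable_eq:
  assumes "expressible T k0 n g" "expressible T k0 n h"
  shows "definable T k0 n (\<lambda>v v'. g v v' = h v v')"
proof -
  have "expressible T k0 n (\<lambda>v v'. g v v' + (- 1) * h v v')"
    by (intro expressible_add expressible_mult expressible_const assms uminus_in_subfield
        subfield_real_1 k0)
  then show ?thesis by (rule definableI) simp
qed

text \<open>Over the reals a sum of two squares vanishes only if both terms do.\<close>

lemma definable_conj:
  assumes "definable T k0 n R" "definable T k0 n R'"
  shows "definable T k0 n (\<lambda>v v'. R v v' \<and> R' v v')"
proof -
  from assms obtain g h where gh: "expressible T k0 n g" "expressible T k0 n h"
    "\<And>v v'. R v v' \<longleftrightarrow> g v v' = 0" "\<And>v v'. R' v v' \<longleftrightarrow> h v v' = 0"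
    unfolding definable_def by blast
  have "expressible T k0 n (\<lambda>v v'. g v v' * g v v' + h v v' * h v v')"
    by (intro expressible_add expressible_mult gh)
  then show ?thesis
    by (rule definableI) (simp add: gh sum_squares_eq_zero_iff)
qed

text \<open>Sequences have zero divisors, but a relation is evaluated at one index, where a product
  of reals vanishes only if a factor does. Which disjunct holds may vary with the index, as an
  automaton requires.\<close>

lemma definable_disj:
  assumes "definable T k0 n R" "definable T k0 n R'"
  shows "definable T k0 n (\<lambda>v v'. R v v' \<or> R' v v')"
proof -
  from assms obtain g h where gh: "expressible T k0 n g" "expressible T k0 n h"
    "\<And>v v'. R v v' \<longleftrightarrow> g v v' = 0" "\<And>v v'. R' v v' \<longleftrightarrow> h v v' = 0"
    unfolding definable_def by blast
  have "expressible T k0 n (\<lambda>v v'. g v v' * h v v')"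
    by (intro expressible_mult gh)
  then show ?thesis
    by (rule definableI) (simp add: gh)
qed

lemma definable_True: "definable T k0 n (\<lambda>v v'. True)"
  using definable_eq[OF expressible_const expressible_const, of 0 0] subfield_real_0[OF k0] by simp

lemma definable_False: "definable T k0 n (\<lambda>v v'. False)"
  using definable_eq[OF expressible_const expressible_const, of 0 1]
    subfield_real_0[OF k0] subfield_real_1[OF k0] by simp

lemma definable_ball:
  assumes "finite A" "\<And>a. a \<in> A \<Longrightarrow> definable T k0 n (R a)"
  shows "definable T k0 n (\<lambda>v v'. \<forall>a\<in>A. R a v v')"
  using assms by (induction A rule: finite_induct) (simp_all add: definable_True definable_conj)

lemma definable_bex:
  assumes "finite A" "\<And>a. a \<in> A \<Longrightarrow> definable T k0 n (R a)"
  shows "definable T k0 n (\<lambda>v v'. \<exists>a\<in>A. R a v v')"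
  using assms by (induction A rule: finite_induct) (simp_all add: definable_False definable_disj)

end

section \<open>The system of a program\<close>

text \<open>The unknowns 0 and 1 are constant and carry the input, 2 is the clock, 3 the number of the
  current stack, and \<open>4 + w\<close> is the register \<open>w\<close>.\<close>

fun regs_below :: "nat \<Rightarrow> atom \<Rightarrow> bool" where
  "regs_below M (Lin x a y b) \<longleftrightarrow> x < M \<and> y < M"
| "regs_below M (Test x y) \<longleftrightarrow> x < M \<and> y < M"

fun act_real :: "nat \<Rightarrow> atom \<Rightarrow> (nat \<Rightarrow> real) \<Rightarrow> (nat \<Rightarrow> real) \<Rightarrow> bool" where
  "act_real M (Lin x a y b) v v' \<longleftrightarrow>
     v' (4 + x) = real a * v (4 + y) + real b \<and> (\<forall>w\<in>{..<M} - {x}. v' (4 + w) = v (4 + w))"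
| "act_real M (Test x y) v v' \<longleftrightarrow> v (4 + x) = v (4 + y) \<and> (\<forall>w\<in>{..<M}. v' (4 + w) = v (4 + w))"

definition transition ::
  "nat \<Rightarrow> (prog list \<Rightarrow> nat) \<Rightarrow> prog list \<times> atom \<times> prog list \<Rightarrow> (nat \<Rightarrow> real) \<Rightarrow> (nat \<Rightarrow> real) \<Rightarrow> bool" where
  "transition M idx e v v' \<longleftrightarrow>
     v 3 = real (idx (fst e)) \<and> v' 3 = real (idx (snd (snd e))) \<and> act_real M (fst (snd e)) v v'"

text \<open>The clock, unknown 2, is left free: it may jump here to whatever value the next stretch
  requires. Unknowns 4 and 5 are the input registers 0 and 1.\<close>

definition restart :: "nat \<Rightarrow> nat \<Rightarrow> nat \<Rightarrow> (nat \<Rightarrow> real) \<Rightarrow> (nat \<Rightarrow> real) \<Rightarrow> bool" where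
  "restart M final start v v' \<longleftrightarrow> v 3 = real final \<and> v' 3 = real start \<and>
     v' 4 = v 0 \<and> v' 5 = v 1 \<and> (\<forall>w\<in>{2..<M}. v' (4 + w) = 0)"

definition tick :: "(nat \<Rightarrow> real) \<Rightarrow> (nat \<Rightarrow> real) \<Rightarrow> bool" where
  "tick v v' \<longleftrightarrow> v 2 = 1 + v' 2 * v' 2"

definition holds_regs :: "nat \<Rightarrow> regs \<Rightarrow> (nat \<Rightarrow> real) \<Rightarrow> bool" where
  "holds_regs M s v \<longleftrightarrow> (\<forall>w<M. v (4 + w) = real (s w))"

text \<open>The unknowns are real, but natural register contents stay natural, since assignments
  have natural coefficients. From a restart on, solutions thus follow genuine computations.\<close>

lemma act_real_sound:
  assumes "act_real M a v v'" "holds_regs M s v" "regs_below M a"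
  shows "\<exists>s'. (s, s') \<in> act a \<and> holds_regs M s' v'"
proof (cases a)
  case (Lin x c y b)
  with assms have "holds_regs M (s(x := c * s y + b)) v'"
    by (auto simp: holds_regs_def)
  with Lin show ?thesis by auto
next
  case (Test x y)
  with assms have "holds_regs M s v'" "s x = s y"
    by (auto simp: holds_regs_def)
  with Test show ?thesis by auto
qed

lemma act_real_complete:
  assumes "(s, s') \<in> act a" "holds_regs M s v" "holds_regs M s' v'" "regs_below M a"
  shows "act_real M a v v'"
  using assms by (cases a) (auto simp: holds_regs_def)

lemma definable_act_real:
  assumes k0: "subfield k0 real_field" and "regs_below M a"
  shows "definable T k0 (4 + M) (act_real M a)"
proof (cases a)
  case (Lin x c y b)
  have eq: "act_real M a = (\<lambda>v v'. v' (4 + x) = real c * v (4 + y) + real b \<and>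
      (\<forall>w\<in>{..<M} - {x}. v' (4 + w) = v (4 + w)))"
    by (simp add: Lin fun_eq_iff)
  show ?thesis
    unfolding eq using assms(2) Lin
    by (intro definable_conj[OF k0] definable_ball[OF k0] definable_eq[OF k0] expressible_add[OF k0]
        expressible_mult[OF k0] expressible_const[OF k0] expressible_now[OF k0]
        expressible_next[OF k0] of_nat_in_subfield[OF k0]) auto
next
  case (Test x y)
  have eq: "act_real M a = (\<lambda>v v'. v (4 + x) = v (4 + y) \<and> (\<forall>w\<in>{..<M}. v' (4 + w) = v (4 + w)))"
    by (simp add: Test fun_eq_iff)
  show ?thesis
    unfolding eq using assms(2) Test
    by (intro definable_conj[OF k0] definable_ball[OF k0] definable_eq[OF k0]
        expressible_now[OF k0] expressible_next[OF k0]) auto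
qed

section \<open>Finiteness of the stretches between restarts\<close>

lemma backward_squares_terminate:
  fixes t :: "nat \<Rightarrow> real"
  assumes "\<And>i. N \<le> i \<Longrightarrow> t i = 1 + t (Suc i) * t (Suc i)"
  shows False
proof -
  have pos: "t i \<ge> 0" if "N \<le> i" for i
    using assms[OF that] by simp
  have dec: "t (Suc i) \<le> t i - 3 / 4" if "N \<le> i" for i
  proof -
    \<comment> \<open>Completing the square: \<open>1 + u^2 - u = (u - 1/2)^2 + 3/4\<close> with
      \<open>u = t (Suc i)\<close>.\<close>
    have "0 \<le> (t (Suc i) - 1 / 2)\<^sup>2" by simp
    then show ?thesis
      unfolding assms[OF that] by (simp add: power2_eq_square algebra_simps)
  qed
  have "t (N + m) \<le> t N - 3 / 4 * real m" for m
  proof (induction m)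
    case (Suc m)
    then show ?case using dec[of "N + m"] by (simp add: field_simps)
  qed simp
  moreover obtain m where "t N < 3 / 4 * real m"
    using reals_Archimedean3[of "3 / 4 :: real"] by (auto simp: mult.commute)
  ultimately show False
    using pos[of "N + m"] by (smt (verit) le_add1)
qed

definition start_regs :: "nat \<Rightarrow> nat \<Rightarrow> regs" where
  "start_regs a b = (\<lambda>_. 0)(0 := a, 1 := b)"

fun clock :: "nat \<Rightarrow> nat" where
  "clock 0 = 0"
| "clock (Suc m) = 1 + clock m * clock m"

text \<open>Finiteness of \<open>S\<close> makes \<open>run\<close> a finite disjunction, closure
  under edges keeps computations inside \<open>S\<close>, and the bound 2 leaves room for the two
  input registers.\<close>

locale numbered_program =
  fixes c :: prog and S :: "prog list set" and idx :: "prog list \<Rightarrow> nat" and M :: nat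
  assumes finite_S: "finite S"
    and start_in_S: "[c] \<in> S" and final_in_S: "[] \<in> S"
    and edge_in_S: "K \<in> S \<Longrightarrow> edge K a K' \<Longrightarrow> K' \<in> S"
    and inj_idx: "inj_on idx S"
    and two_le_M: "2 \<le> M"
    and regs_below_M: "K \<in> S \<Longrightarrow> edge K a K' \<Longrightarrow> regs_below M a"
begin

definition edges :: "(prog list \<times> atom \<times> prog list) set" where
  "edges = {(K, a, K'). K \<in> S \<and> edge K a K'}"

definition run :: "(nat \<Rightarrow> real) \<Rightarrow> (nat \<Rightarrow> real) \<Rightarrow> bool" where
  "run v v' \<longleftrightarrow> (\<exists>e\<in>edges. transition M idx e v v') \<and> tick v v' \<or>
     restart M (idx []) (idx [c]) v v'"

lemma definable_run:
  assumes k0: "subfield k0 real_field"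
  shows "definable T k0 (4 + M) run"
  unfolding run_def[abs_def] transition_def tick_def restart_def
  using two_le_M finite_edges[OF finite_S] regs_below_M
  by (intro definable_disj[OF k0] definable_bex[OF k0] definable_conj[OF k0] definable_ball[OF k0]
      definable_act_real[OF k0] definable_eq[OF k0] expressible_add[OF k0] expressible_mult[OF k0]
      expressible_const[OF k0] expressible_now[OF k0] expressible_next[OF k0] of_nat_in_subfield[OF k0]
      subfield_real_0[OF k0] subfield_real_1[OF k0]) (auto simp: edges_def)

text \<open>Two successive restarts frame a computation: after the first the machine is in its start
  configuration, before the second its stack is empty, and every step in between is a
  transition.\<close>

lemma run_imp_halts:
  assumes run: "\<And>i. run (y i) (y (Suc i))"
    and input: "\<And>i. y i 0 = real a" "\<And>i. y i 1 = real b"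
  shows "\<exists>s'. (([c], start_regs a b), ([], s')) \<in> step\<^sup>*"
proof -
  let ?restart = "\<lambda>i. restart M (idx []) (idx [c]) (y i) (y (Suc i))"
  have ex_restart: "\<exists>i\<ge>N. ?restart i" for N
  proof (rule ccontr)
    assume "\<not> ?thesis"
    with run have "y i 2 = 1 + y (Suc i) 2 * y (Suc i) 2" if "N \<le> i" for i
      using that by (auto simp: run_def tick_def)
    then show False by (rule backward_squares_terminate)
  qed
  obtain i0 where i0: "?restart i0" using ex_restart[of 0] by blast
  \<comment> \<open>The restart at \<open>i0\<close> relates \<open>i0\<close> to
    \<open>Suc i0\<close>, so the computation begins at \<open>Suc i0\<close>; minimality of
    \<open>d\<close> excludes restarts before \<open>Suc i0 + d\<close>.\<close>
  define d where "d = (LEAST d. ?restart (Suc i0 + d))"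
  have "\<exists>d. ?restart (Suc i0 + d)"
    using ex_restart[of "Suc i0"] by (metis le_iff_add)
  then have last: "?restart (Suc i0 + d)"
    unfolding d_def by (rule LeastI_ex)
  have "\<exists>K s. K \<in> S \<and> (([c], start_regs a b), (K, s)) \<in> step\<^sup>* \<and> y (Suc i0 + m) 3 = real (idx K) \<and>
      holds_regs M s (y (Suc i0 + m))" if "m \<le> d" for m
    using that
  proof (induction m)
    case 0
    have "holds_regs M (start_regs a b) (y (Suc i0))"
      unfolding holds_regs_def
    proof (intro allI impI)
      fix w assume "w < M"
      consider "w = 0" | "w = 1" | "w \<in> {2..<M}" using \<open>w < M\<close> by fastforce
      then show "y (Suc i0) (4 + w) = real (start_regs a b w)"
        using i0 input by cases (auto simp: restart_def start_regs_def)
    qed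
    with i0 start_in_S show ?case
      by (intro exI[of _ "[c]"] exI[of _ "start_regs a b"]) (simp add: restart_def)
  next
    case (Suc m)
    then obtain K s where K: "K \<in> S" "(([c], start_regs a b), (K, s)) \<in> step\<^sup>*"
      "y (Suc i0 + m) 3 = real (idx K)" "holds_regs M s (y (Suc i0 + m))" by auto
    have "\<not> ?restart (Suc i0 + m)"
      using Suc.prems not_less_Least[of m "\<lambda>d. ?restart (Suc i0 + d)"] by (simp add: d_def)
    with run[of "Suc i0 + m"] obtain L act' L' where e: "L \<in> S" "edge L act' L'"
      "transition M idx (L, act', L') (y (Suc i0 + m)) (y (Suc i0 + Suc m))"
      by (auto simp: run_def edges_def)
    then have "L = K"
      using K inj_onD[OF inj_idx, of L K] by (simp add: transition_def)
    obtain s' where "(s, s') \<in> act act'" "holds_regs M s' (y (Suc i0 + Suc m))"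
      using act_real_sound[OF _ K(4) regs_below_M[OF e(1,2)]] e(3) by (auto simp: transition_def)
    moreover from this have "((K, s), (L', s')) \<in> step"
      using e(2) \<open>L = K\<close> by (auto simp: step_def)
    ultimately show ?case
      using K(2) edge_in_S[OF e(1,2)] e(3)
      by (intro exI[of _ L'] exI[of _ s'])
         (auto simp: transition_def intro: rtrancl_into_rtrancl)
  qed
  from this[of d] obtain K s where K: "K \<in> S" "(([c], start_regs a b), (K, s)) \<in> step\<^sup>*"
    "y (Suc i0 + d) 3 = real (idx K)" by blast
  from K(1,3) last have "K = []"
    using inj_onD[OF inj_idx, of K "[]"] final_in_S by (simp add: restart_def)
  with K(2) show ?thesis by blast
qed

text \<open>An accepting run of \<open>l\<close> steps and the restart after it form a cycle of
  \<open>Suc l\<close> positions. Only values below \<open>4 + M\<close> are prescribed, since a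
  solution tuple has no meaningful entries beyond them.\<close>

lemma halts_imp_run:
  assumes "(([c], start_regs a b), ([], s')) \<in> step\<^sup>*"
  obtains Y and l :: nat where
    "\<And>i w. Y i w \<in> \<nat>" "\<And>i. Y i 0 = real a" "\<And>i. Y i 1 = real b"
    "\<And>i v v'. i \<le> l \<Longrightarrow> \<forall>w<4 + M. v w = Y i w \<Longrightarrow>
       \<forall>w<4 + M. v' w = Y (Suc i mod Suc l) w \<Longrightarrow> run v v'"
proof -
  obtain l where "(([c], start_regs a b), ([], s')) \<in> step ^^ l"
    using assms by (auto simp: rtrancl_power)
  then obtain cf where cf: "cf 0 = ([c], start_regs a b)" "cf l = ([], s')"
    "\<And>i. i < l \<Longrightarrow> (cf i, cf (Suc i)) \<in> step"
    unfolding relpow_fun_conv by blast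
  have S: "fst (cf i) \<in> S" if "i \<le> l" for i
    using that
  proof (induction i)
    case 0
    show ?case by (simp add: cf start_in_S)
  next
    case (Suc i)
    then have "(cf i, cf (Suc i)) \<in> step" "fst (cf i) \<in> S" using cf(3) by simp_all
    then show ?case by (auto simp: step_def intro: edge_in_S)
  qed
  \<comment> \<open>The clock is 0 at position \<open>l\<close>, the restart, where no
    \<open>tick\<close> is required; the earlier values are computed backwards from it.\<close>
  define Y :: "nat \<Rightarrow> nat \<Rightarrow> real" where "Y = (\<lambda>i w. real (if w = 0 then a else if w = 1 then b else
    if w = 2 then clock (l - i) else if w = 3 then idx (fst (cf i)) else snd (cf i) (w - 4)))"
  show thesis
  proof (rule that[of Y l])
    fix i v v' assume i: "i \<le> l" and v: "\<forall>w<4 + M. v w = Y i w"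
      and v': "\<forall>w<4 + M. v' w = Y (Suc i mod Suc l) w"
    have regs: "holds_regs M (snd (cf i)) v" "holds_regs M (snd (cf (Suc i mod Suc l))) v'"
      using v v' by (auto simp: holds_regs_def Y_def)
    show "run v v'"
    proof (cases "i = l")
      case True
      have "v' (4 + w) = real (start_regs a b w)" if "w < M" for w
        using regs(2) that by (simp add: True cf holds_regs_def)
      from this[of 0] this[of 1] this have "v' 4 = real a" "v' 5 = real b" "\<forall>w\<in>{2..<M}. v' (4 + w) = 0"
        using two_le_M by (auto simp: start_regs_def)
      moreover have "v 0 = real a" "v 1 = real b" "v 3 = real (idx [])"
        using v by (simp_all add: Y_def True cf)
      moreover have "v' 3 = real (idx [c])"
        using v' by (simp add: Y_def True cf)
      ultimately show ?thesis by (simp add: run_def restart_def)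
    next
      case False
      with i have i: "i < l" by simp
      then have mod: "Suc i mod Suc l = Suc i" by simp
      from cf(3)[OF i] obtain act' where e: "edge (fst (cf i)) act' (fst (cf (Suc i)))"
        "(snd (cf i), snd (cf (Suc i))) \<in> act act'"
        by (auto simp: step_def)
      have "fst (cf i) \<in> S" using S i by simp
      note below = regs_below_M[OF this e(1)]
      have "act_real M act' v v'"
        using regs by (intro act_real_complete[OF e(2) _ _ below]) (simp_all only: mod)
      moreover have "v 3 = real (idx (fst (cf i)))" "v' 3 = real (idx (fst (cf (Suc i))))"
        using v v' by (simp_all add: Y_def mod)
      ultimately have "transition M idx (fst (cf i), act', fst (cf (Suc i))) v v'"
        by (simp add: transition_def)
      moreover have "(fst (cf i), act', fst (cf (Suc i))) \<in> edges"
        using e(1) \<open>fst (cf i) \<in> S\<close> by (simp add: edges_def)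
      moreover have "tick v v'"
      proof -
        have "l - i = Suc (l - Suc i)" using i by simp
        then have "clock (l - i) = 1 + clock (l - Suc i) * clock (l - Suc i)"
          by (metis clock.simps(2))
        then show ?thesis using v v' by (simp add: tick_def Y_def mod)
      qed
      ultimately show ?thesis unfolding run_def by blast
    qed
  qed (simp_all add: Y_def)
qed

end

lemma ex_numbered_program: "\<exists>S idx M. numbered_program c S idx M"
proof -
  let ?S = "conts c []"
  obtain idx :: "prog list \<Rightarrow> nat" where idx: "inj_on idx ?S"
    using finite_imp_inj_to_nat_seg[OF finite_conts] by blast
  have ex_bound: "\<exists>M. regs_below M a" for a
  proof (cases a)
    case (Lin x _ y _)
    then show ?thesis by (auto intro!: exI[of _ "Suc (x + y)"])
  next
    case (Test x y)
    then show ?thesis by (auto intro!: exI[of _ "Suc (x + y)"])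
  qed
  then obtain B where B: "\<And>a. regs_below (B a) a" by metis
  have mono: "regs_below M' a" if "regs_below M a" "M \<le> M'" for M M' a
    using that by (cases a) auto
  let ?E = "{(K, a, K'). K \<in> ?S \<and> edge K a K'}"
  \<comment> \<open>The sum is a convenient common bound for the finitely many edges.\<close>
  define M where "M = 2 + (\<Sum>e\<in>?E. B (fst (snd e)))"
  have "regs_below M a" if "K \<in> ?S" "edge K a K'" for K a K'
  proof (rule mono[OF B])
    have "B (fst (snd (K, a, K'))) \<le> (\<Sum>e\<in>?E. B (fst (snd e)))"
      using that finite_edges[OF finite_conts] by (intro member_le_sum) auto
    then show "B a \<le> M" by (simp add: M_def)
  qed
  then have "numbered_program c ?S idx M"
    using conts_ends[of c "[]"] idx
    by unfold_locales (auto simp: finite_conts M_def intro: conts_edge)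
  then show ?thesis by blast
qed

text \<open>The polynomial \<open>X_j - a\<close>. The shape of its term list is independent of
  \<open>a\<close>, so its code depends on \<open>a\<close> only through the code of
  \<open>- real a\<close>.\<close>

definition input :: "nat \<Rightarrow> nat \<Rightarrow> dterm list" where
  "input j a = [(1, [((j, 0), 1)]), (- real a, [])]"

lemma dpoly_eval_input: "dpoly_eval x (poly_of (input j a)) = 0 \<longleftrightarrow> (\<forall>i. x j i = real a)"
  by (simp add: input_def poly_of_def mono_of_def dpoly_eval_add dpoly_eval_single dmono_eval_single fun_eq_iff)

text \<open>That \<open>n\<close> and \<open>fs\<close> do not depend on \<open>a\<close> and
  \<open>b\<close> is what permits self-application later. \<open>succs\<close> is a forward path of
  indices along which a solution is read; \<open>residue\<close> wraps the index set around a cycle,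
  turning an accepting run into a periodic solution.\<close>

theorem halting_reduces_to_solvability:
  fixes succs :: "nat \<Rightarrow> 'm::{plus,one}"
  assumes succs: "\<And>i. succs (Suc i) = succs i + 1"
    and residue: "\<And>l. \<exists>\<pi> :: 'm \<Rightarrow> nat. \<forall>i. \<pi> i \<le> l \<and> \<pi> (i + 1) = Suc (\<pi> i) mod Suc l"
    and k: "subfield k real_field" and k0: "subfield k0 real_field"
  shows "\<exists>n fs. (\<forall>a b. (n, input 0 a # input 1 b # fs) \<in> dsystems k0 \<and>
    ((solutions k n (polys_of (input 0 a # input 1 b # fs)) :: (nat \<Rightarrow> 'm \<Rightarrow> real) set) \<noteq> {} \<longleftrightarrow>
      (\<exists>y. rec_eval p [a, b] y)))"
proof -
  obtain c where c: "\<And>s s'. (s, s') \<in> exec c \<Longrightarrow> rec_eval p (map s [0, 1]) (s' 2)"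
    "\<And>s y. rec_eval p (map s [0, 1]) y \<Longrightarrow> \<exists>s'. (s, s') \<in> exec c \<and> s' 2 = y"
    using compilable[of p] by (elim compilableD[of p "[0, 1]" 3 2]) auto
  have "map (start_regs a b) [0, 1] = [a, b]" for a b
    by (simp add: start_regs_def)
  then have halts: "(\<exists>y. rec_eval p [a, b] y) \<longleftrightarrow> (\<exists>s'. (([c], start_regs a b), ([], s')) \<in> step\<^sup>*)" for a b
    using c[of "start_regs a b"] unfolding steps_iff_exec by metis
  obtain S idx M where "numbered_program c S idx M"
    using ex_numbered_program by blast
  then interpret numbered_program c S idx M .
  define n where "n = 4 + M"
  obtain f where f: "f \<in> dpolys k0 n"
    "\<And>(x :: nat \<Rightarrow> 'm \<Rightarrow> real) i. dpoly_eval x f i = 0 \<longleftrightarrow> run (\<lambda>w. x w i) (\<lambda>w. x w (i + 1))"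
    using definable_run[OF k0, of "TYPE('m)"] unfolding definable_def expressible_def n_def by metis
  obtain fs where fs: "(n, fs) \<in> dsystems k0" "polys_of fs = {f}"
    using dsystems_complete[of "{f}" k0 n] f(1) by auto
  have "(n, input 0 a # input 1 b # fs) \<in> dsystems k0" for a b
    using fs(1) subfield_real_1[OF k0] uminus_in_subfield[OF k0 of_nat_in_subfield[OF k0]]
    by (simp add: dsystems_def input_def n_def)
  moreover have "(solutions k n (polys_of (input 0 a # input 1 b # fs)) :: (nat \<Rightarrow> 'm \<Rightarrow> real) set) \<noteq> {} \<longleftrightarrow>
      (\<exists>y. rec_eval p [a, b] y)" for a b
  proof -
    have polys: "polys_of (input 0 a # input 1 b # fs) = {poly_of (input 0 a), poly_of (input 1 b), f}"
      using fs(2) by (simp add: polys_of_def)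
    have sol: "x \<in> solutions k n (polys_of (input 0 a # input 1 b # fs)) \<longleftrightarrow>
        x \<in> {..<n} \<rightarrow>\<^sub>E seqs k \<and> (\<forall>i. x 0 i = real a) \<and> (\<forall>i. x 1 i = real b) \<and>
        (\<forall>i. run (\<lambda>w. x w i) (\<lambda>w. x w (i + 1)))" for x :: "nat \<Rightarrow> 'm \<Rightarrow> real"
    proof -
      have "dpoly_eval x f = 0 \<longleftrightarrow> (\<forall>i. run (\<lambda>w. x w i) (\<lambda>w. x w (i + 1)))"
        by (simp add: fun_eq_iff f(2))
      then show ?thesis
        unfolding polys solutions_def by (simp add: dpoly_eval_input)
    qed
    show ?thesis
    proof
      assume "(solutions k n (polys_of (input 0 a # input 1 b # fs)) :: (nat \<Rightarrow> 'm \<Rightarrow> real) set) \<noteq> {}"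
      then obtain x :: "nat \<Rightarrow> 'm \<Rightarrow> real" where x: "\<forall>i. x 0 i = real a" "\<forall>i. x 1 i = real b"
        "\<forall>i. run (\<lambda>w. x w i) (\<lambda>w. x w (i + 1))"
        using sol by blast
      have "\<exists>s'. (([c], start_regs a b), ([], s')) \<in> step\<^sup>*"
        by (rule run_imp_halts[of "\<lambda>i w. x w (succs i)"]) (use x in \<open>simp_all add: succs\<close>)
      then show "\<exists>y. rec_eval p [a, b] y" using halts by blast
    next
      assume "\<exists>y. rec_eval p [a, b] y"
      then obtain s' where "(([c], start_regs a b), ([], s')) \<in> step\<^sup>*" using halts by blast
      then obtain Y and l :: nat where Y: "\<And>i w. Y i w \<in> \<nat>" "\<And>i. Y i 0 = real a" "\<And>i. Y i 1 = real b"
        "\<And>i v v'. i \<le> l \<Longrightarrow> \<forall>w<4 + M. v w = Y i w \<Longrightarrow>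
          \<forall>w<4 + M. v' w = Y (Suc i mod Suc l) w \<Longrightarrow> run v v'"
        by (rule halts_imp_run) blast
      obtain \<pi> :: "'m \<Rightarrow> nat" where \<pi>: "\<And>i. \<pi> i \<le> l" "\<And>i. \<pi> (i + 1) = Suc (\<pi> i) mod Suc l"
        using residue[of l] by blast
      \<comment> \<open>The default \<open>undefined\<close> is forced, as \<open>solutions\<close>
        consists of extensional tuples.\<close>
      define x :: "nat \<Rightarrow> 'm \<Rightarrow> real" where "x = (\<lambda>w. if w < n then (\<lambda>i. Y (\<pi> i) w) else undefined)"
      have "Y i w \<in> k" for i w
        using Y(1)[of i w] of_nat_in_subfield[OF k] by (auto elim: Nats_cases)
      then have "x \<in> {..<n} \<rightarrow>\<^sub>E seqs k"
        by (auto simp: x_def seqs_def)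
      moreover have "run (\<lambda>w. x w i) (\<lambda>w. x w (i + 1))" for i
        by (rule Y(4)[OF \<pi>(1)[of i]]) (simp_all add: x_def n_def \<pi>(2))
      moreover have "x 0 i = real a" "x 1 i = real b" for i
        using Y(2,3) by (simp_all add: x_def n_def)
      ultimately have "x \<in> solutions k n (polys_of (input 0 a # input 1 b # fs))"
        unfolding sol by blast
      then show "(solutions k n (polys_of (input 0 a # input 1 b # fs)) :: (nat \<Rightarrow> 'm \<Rightarrow> real) set) \<noteq> {}"
        by blast
    qed
  qed
  ultimately show ?thesis by blast
qed

section \<open>Computing the code of the self-application\<close>

definition total_rec :: "nat \<Rightarrow> (nat list \<Rightarrow> nat) \<Rightarrow> bool" where
  "total_rec ar F \<longleftrightarrow> (\<exists>r. \<forall>xs. length xs = ar \<longrightarrow> rec_eval r xs (F xs))"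

lemma total_rec_proj: "i < ar \<Longrightarrow> total_rec ar (\<lambda>xs. xs ! i)"
  unfolding total_rec_def by (metis rec_eval.proj)

lemma total_rec_comp1:
  assumes "\<And>y. rec_eval r [y] (G y)" "total_rec ar F"
  shows "total_rec ar (\<lambda>xs. G (F xs))"
proof -
  from assms(2) obtain q where "\<And>xs. length xs = ar \<Longrightarrow> rec_eval q xs (F xs)"
    unfolding total_rec_def by blast
  then have "length xs = ar \<Longrightarrow> rec_eval (Comp_rf r [q]) xs (G (F xs))" for xs
    using assms(1) by (intro rec_eval.comp[of xs _ "[F xs]"]) auto
  then show ?thesis unfolding total_rec_def by blast
qed

lemma total_rec_comp2:
  assumes "\<And>y z. rec_eval r [y, z] (G y z)" "total_rec ar F" "total_rec ar F'"
  shows "total_rec ar (\<lambda>xs. G (F xs) (F' xs))"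
proof -
  from assms(2,3) obtain q q' where "\<And>xs. length xs = ar \<Longrightarrow> rec_eval q xs (F xs)"
    "\<And>xs. length xs = ar \<Longrightarrow> rec_eval q' xs (F' xs)"
    unfolding total_rec_def by blast
  then have "length xs = ar \<Longrightarrow> rec_eval (Comp_rf r [q, q']) xs (G (F xs) (F' xs))" for xs
    using assms(1) by (intro rec_eval.comp[of xs _ "[F xs, F' xs]"]) auto
  then show ?thesis unfolding total_rec_def by blast
qed

lemma total_rec_Suc: "total_rec ar F \<Longrightarrow> total_rec ar (\<lambda>xs. Suc (F xs))"
  by (rule total_rec_comp1[OF rec_eval.succ])

lemma total_rec_const: "total_rec ar (\<lambda>xs. m)"
proof (induction m)
  case 0
  show ?case unfolding total_rec_def by (blast intro: rec_eval.zero)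
qed (rule total_rec_Suc)

lemma total_rec_add:
  assumes "total_rec ar F" "total_rec ar G"
  shows "total_rec ar (\<lambda>xs. F xs + G xs)"
proof -
  have "rec_eval (Prim_rf (Proj_rf 0) (Comp_rf Succ_rf [Proj_rf 1])) [y, z] (y + z)" for y z
  proof (induction y)
    case 0
    show ?case using rec_eval.prim_0[OF rec_eval.proj[of 0 "[z]"]] by simp
  next
    case (Suc y)
    have "rec_eval (Comp_rf Succ_rf [Proj_rf 1]) [y, y + z, z] (Suc (y + z))"
      using rec_eval.proj[of 1 "[y, y + z, z]"]
      by (intro rec_eval.comp[where ys = "[y + z]"] rec_eval.succ) simp
    from rec_eval.prim_Suc[OF Suc this] show ?case by simp
  qed
  from total_rec_comp2[OF this assms] show ?thesis .
qed

lemma total_rec_primrec: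
  assumes step: "total_rec 2 (\<lambda>xs. H (xs ! 0) (xs ! 1))" and F: "total_rec ar F"
    and G: "G 0 = g0" "\<And>y. G (Suc y) = H y (G y)"
  shows "total_rec ar (\<lambda>xs. G (F xs))"
proof -
  obtain h where h: "\<And>xs. length xs = 2 \<Longrightarrow> rec_eval h xs (H (xs ! 0) (xs ! 1))"
    using step unfolding total_rec_def by blast
  obtain z where z: "rec_eval z [] g0"
    using total_rec_const[of 0 g0] unfolding total_rec_def by auto
  have "rec_eval (Prim_rf z h) [y] (G y)" for y
  proof (induction y)
    case 0
    show ?case using rec_eval.prim_0[OF z] by (simp add: G)
  next
    case (Suc y)
    show ?case using rec_eval.prim_Suc[OF Suc] h[of "[y, G y]"] by (simp add: G)
  qed
  from total_rec_comp1[OF this F] show ?thesis .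
qed

lemma total_rec_prod_encode:
  assumes F: "total_rec ar F" and G: "total_rec ar G"
  shows "total_rec ar (\<lambda>xs. prod_encode (F xs, G xs))"
proof -
  \<comment> \<open>The recursion step of \<open>triangle\<close>, with the counter in
    \<open>xs ! 0\<close> and the previous value in \<open>xs ! 1\<close>.\<close>
  have "total_rec 2 (\<lambda>xs. xs ! 1 + Suc (xs ! 0))"
    by (intro total_rec_add total_rec_Suc total_rec_proj) simp_all
  from total_rec_primrec[OF this total_rec_add[OF F G], of triangle 0]
  have "total_rec ar (\<lambda>xs. triangle (F xs + G xs))" by simp
  from total_rec_add[OF this F] show ?thesis by (simp add: prod_encode_def)
qed

text \<open>The numbering \<open>\<nu>\<close> is given only abstractly, so the code of
  \<open>- m\<close> is reached from \<open>\<nu> 0\<close> by adding \<open>- 1\<close> repeatedly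
  with the addition procedure of the field; \<open>\<nu> 0\<close> and \<open>\<nu> (- 1)\<close>
  are built in as constants.\<close>

lemma total_rec_neg_code:
  assumes k0: "computable_field k0 \<nu>" and F: "total_rec ar F"
  shows "total_rec ar (\<lambda>xs. \<nu> (- real (F xs)))"
proof -
  have sub: "subfield k0 real_field" using k0 by (simp add: computable_field_def)
  have in_k0: "- real m \<in> k0" for m
    by (rule uminus_in_subfield[OF sub of_nat_in_subfield[OF sub]])
  obtain r where r: "\<And>a b. a \<in> k0 \<Longrightarrow> b \<in> k0 \<Longrightarrow> rec_eval r [\<nu> a, \<nu> b] (\<nu> (a + b))"
    using k0 unfolding computable_field_def by blast
  obtain q where q: "\<And>xs. length xs = 2 \<Longrightarrow> rec_eval q xs (\<nu> (- 1))"
    using total_rec_const[of 2 "\<nu> (- 1)"] unfolding total_rec_def by blast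
  obtain z where z: "rec_eval z [] (\<nu> 0)"
    using total_rec_const[of 0 "\<nu> 0"] unfolding total_rec_def by auto
  have "rec_eval (Prim_rf z (Comp_rf r [Proj_rf 1, q])) [y] (\<nu> (- real y))" for y
  proof (induction y)
    case 0
    show ?case using rec_eval.prim_0[OF z] by simp
  next
    case (Suc y)
    have "rec_eval (Comp_rf r [Proj_rf 1, q]) [y, \<nu> (- real y)] (\<nu> (- real y + - 1))"
      using rec_eval.proj[of 1 "[y, \<nu> (- real y)]"] q[of "[y, \<nu> (- real y)]"] r[OF in_k0 in_k0, of y 1]
      by (intro rec_eval.comp[where ys = "[\<nu> (- real y), \<nu> (- 1)]"]) simp_all
    from rec_eval.prim_Suc[OF Suc this] show ?case by (simp add: add.commute)
  qed
  from total_rec_comp1[OF this F] show ?thesis .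
qed

lemma total_rec_input_code:
  assumes "computable_field k0 \<nu>" "total_rec ar F"
  shows "total_rec ar (\<lambda>xs. list_encode (map (term_code \<nu>) (input j (F xs))))"
  unfolding input_def term_code_def
  by (simp, intro total_rec_Suc total_rec_prod_encode total_rec_const total_rec_neg_code[OF assms(1)] assms(2))

text \<open>Given a decision procedure \<open>r\<close>, take the system of the program that halts exactly on those inputs
  \<open>(n, L)\<close> for which \<open>r\<close> declares unsolvable the system with \<open>n\<close> unknowns and with list of polynomials
  coded by \<open>L\<close>, extended by \<open>X\<^sub>0 = n\<close> and \<open>X\<^sub>1 = L\<close>; feeding it its own \<open>n\<close> and \<open>L\<close> is contradictory.\<close>

theorem solvability_undecidable:
  fixes succs :: "nat \<Rightarrow> 'm::{plus,one}"
  assumes succs: "\<And>i. succs (Suc i) = succs i + 1"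
    and residue: "\<And>l. \<exists>\<pi> :: 'm \<Rightarrow> nat. \<forall>i. \<pi> i \<le> l \<and> \<pi> (i + 1) = Suc (\<pi> i) mod Suc l"
    and k: "subfield k real_field" and k0: "computable_field k0 \<nu>"
  shows "\<not> decidable_on (dsys_code \<nu>) (dsystems k0)
    (\<lambda>(n, fs). (solutions k n (polys_of fs) :: (nat \<Rightarrow> 'm \<Rightarrow> real) set) \<noteq> {})"
proof
  assume "decidable_on (dsys_code \<nu>) (dsystems k0)
    (\<lambda>(n, fs). (solutions k n (polys_of fs) :: (nat \<Rightarrow> 'm \<Rightarrow> real) set) \<noteq> {})"
  then obtain r where r: "\<And>n fs. (n, fs) \<in> dsystems k0 \<Longrightarrow> rec_eval r [dsys_code \<nu> (n, fs)]
      (if (solutions k n (polys_of fs) :: (nat \<Rightarrow> 'm \<Rightarrow> real) set) \<noteq> {} then 1 else 0)"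
    unfolding decidable_on_def by fastforce
  \<comment> \<open>Since \<open>list_encode (x # xs)\<close> is
    \<open>Suc (prod_encode (x, list_encode xs))\<close>, this is the code of the system with
    \<open>a\<close> unknowns that has the two input polynomials in front of a list coded by
    \<open>b\<close>.\<close>
  define code where "code a b = prod_encode (a,
    Suc (prod_encode (list_encode (map (term_code \<nu>) (input 0 a)),
    Suc (prod_encode (list_encode (map (term_code \<nu>) (input 1 b)), b)))))" for a b
  have "total_rec 3 (\<lambda>xs. code (xs ! 1) (xs ! 2))"
    unfolding code_def
    by (intro total_rec_prod_encode total_rec_Suc total_rec_input_code[OF k0] total_rec_proj) simp_all
  then obtain h where h: "\<And>xs. length xs = 3 \<Longrightarrow> rec_eval h xs (code (xs ! 1) (xs ! 2))"
    unfolding total_rec_def by blast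
  \<comment> \<open>The search variable comes first and \<open>h\<close> disregards it, so the
    search stops at once if \<open>r\<close> answers 0 and never otherwise.\<close>
  define p where "p = Min_rf (Comp_rf r [h])"
  have p: "(\<exists>y. rec_eval p [a, b] y) \<longleftrightarrow> rec_eval r [code a b] 0" for a b
  proof
    assume "\<exists>y. rec_eval p [a, b] y"
    then obtain y where "rec_eval (Comp_rf r [h]) [y, a, b] 0"
      unfolding p_def by (auto elim: rec_eval_elims)
    then obtain z where z: "rec_eval h [y, a, b] z" "rec_eval r [z] 0"
      by (rule rec_eval_elims(4)) (auto simp: list_all2_Cons1)
    then show "rec_eval r [code a b] 0"
      using rec_eval_unique[OF z(1) h[of "[y, a, b]"]] by simp
  next
    assume "rec_eval r [code a b] 0"
    then have "rec_eval (Comp_rf r [h]) [0, a, b] 0"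
      using h[of "[0, a, b]"] by (intro rec_eval.comp[where ys = "[code a b]"]) simp_all
    then have "rec_eval p [a, b] 0"
      unfolding p_def by (rule rec_eval.mini) simp
    then show "\<exists>y. rec_eval p [a, b] y" ..
  qed
  have sub: "subfield k0 real_field" using k0 by (simp add: computable_field_def)
  obtain n fs where sys: "\<And>a b. (n, input 0 a # input 1 b # fs) \<in> dsystems k0"
    and solvable: "\<And>a b. (solutions k n (polys_of (input 0 a # input 1 b # fs)) :: (nat \<Rightarrow> 'm \<Rightarrow> real) set) \<noteq> {} \<longleftrightarrow>
      (\<exists>y. rec_eval p [a, b] y)"
    using halting_reduces_to_solvability[of succs k k0 p, OF succs residue k sub] by blast
  define L where "L = list_encode (map (\<lambda>ts. list_encode (map (term_code \<nu>) ts)) fs)"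
  let ?solvable = "(solutions k n (polys_of (input 0 n # input 1 L # fs)) :: (nat \<Rightarrow> 'm \<Rightarrow> real) set) \<noteq> {}"
  \<comment> \<open>At \<open>a = n\<close> and \<open>b = L\<close>, the number on which
    \<open>p\<close> queries \<open>r\<close> is the code of the extended system itself.\<close>
  have "dsys_code \<nu> (n, input 0 n # input 1 L # fs) = code n L"
    by (simp add: dsys_code_def code_def L_def)
  with r[OF sys] have answer: "rec_eval r [code n L] (if ?solvable then 1 else 0)" by metis
  \<comment> \<open>The system is solvable exactly if \<open>r\<close> declares it
    unsolvable.\<close>
  have "?solvable \<longleftrightarrow> rec_eval r [code n L] 0"
    using solvable p by simp
  then show False
    using answer rec_eval_unique[OF answer, of 0] by (auto split: if_splits)
qed

section \<open>Sequences indexed by the natural numbers and by the integers\<close>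

theorem theorem3p6:
  fixes k k0 :: "real set" and \<nu> :: "real \<Rightarrow> nat"
  assumes "subfield k real_field"
    and "computable_field k0 \<nu>"
    and "k0 \<subseteq> k"
  shows "\<not> decidable_on (dsys_code \<nu>) (dsystems k0)
      (\<lambda>(n, fs). (solutions k n (polys_of fs) :: (nat \<Rightarrow> nat \<Rightarrow> real) set) \<noteq> {}) \<and>
    \<not> decidable_on (dsys_code \<nu>) (dsystems k0)
      (\<lambda>(n, fs). (solutions k n (polys_of fs) :: (nat \<Rightarrow> int \<Rightarrow> real) set) \<noteq> {})"
proof
  have "\<exists>\<pi> :: nat \<Rightarrow> nat. \<forall>i. \<pi> i \<le> l \<and> \<pi> (i + 1) = Suc (\<pi> i) mod Suc l" for l
    by (rule exI[of _ "\<lambda>i. i mod Suc l"]) (simp add: mod_Suc_eq less_Suc_eq_le[symmetric])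
  then show "\<not> decidable_on (dsys_code \<nu>) (dsystems k0)
      (\<lambda>(n, fs). (solutions k n (polys_of fs) :: (nat \<Rightarrow> nat \<Rightarrow> real) set) \<noteq> {})"
    using assms by (intro solvability_undecidable[of "\<lambda>i. i"]) simp_all
next
  \<comment> \<open>With a positive modulus, \<open>mod\<close> is nonnegative for negative integers
    too, so the cycle extends in both directions.\<close>
  have "\<exists>\<pi> :: int \<Rightarrow> nat. \<forall>i. \<pi> i \<le> l \<and> \<pi> (i + 1) = Suc (\<pi> i) mod Suc l" for l
  proof (intro exI allI conjI)
    fix i :: int
    have nonneg: "0 \<le> i mod int (Suc l)" by simp
    have "i mod int (Suc l) < int (Suc l)" by (rule pos_mod_bound) simp
    with nonneg show "nat (i mod int (Suc l)) \<le> l" by linarith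
    have "int (Suc (nat (i mod int (Suc l))) mod Suc l) = (1 + i mod int (Suc l)) mod int (Suc l)"
      using nonneg by (simp only: zmod_int int_Suc nat_0_le add.commute)
    also have "\<dots> = (i + 1) mod int (Suc l)"
      by (simp only: mod_add_right_eq add.commute)
    finally show "nat ((i + 1) mod int (Suc l)) = Suc (nat (i mod int (Suc l))) mod Suc l"
      by linarith
  qed
  then show "\<not> decidable_on (dsys_code \<nu>) (dsystems k0)
      (\<lambda>(n, fs). (solutions k n (polys_of fs) :: (nat \<Rightarrow> int \<Rightarrow> real) set) \<noteq> {})"
    using assms by (intro solvability_undecidable[of int]) simp_all
qed

end
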